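(* Every bounded, uncountable, separable, complete, homogeneous, universal metric space is oscillation stable.
   Context: For a metric space $M=(M;d)$, $\mathrm{dist}(M)=\{d(x,y)\mid x,y\in M\}$. $M$ is homogeneous if every isometry of a finite subspace of $M$ onto a subspace of $M$ extends to an isometry of $M$ onto $M$. $M$ is universal if every finite metric space $F$ with $\mathrm{dist}(F)\subseteq\mathrm{dist}(M)$ embeds isometrically into $M$. An isometric copy of $M$ in $M$ is a subspace of $M$ that is isometric to $M$. $M$ is oscillation stable if for every $\epsilon>0$ and every uniformly continuous and bounded function $f:M\to\mathbb{R}$ there exists an isometric copy $M^\ast$ of $M$ in $M$ with $\sup\{|f(x)-f(y)|\mid x,y\in M^\ast\}<\epsilon$. *)

theory Defs
  imports "HOL-Analysis.Analysis"
begin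

definition dist_set :: "'a metric \<Rightarrow> real set" where
  "dist_set M = {mdist M x y | x y. x \<in> mspace M \<and> y \<in> mspace M}"

definition isometric_embedding :: "'a metric \<Rightarrow> 'b metric \<Rightarrow> ('a \<Rightarrow> 'b) \<Rightarrow> bool" where
  "isometric_embedding M N f \<longleftrightarrow> f \<in> mspace M \<rightarrow> mspace N \<and>
     (\<forall>x \<in> mspace M. \<forall>y \<in> mspace M. mdist N (f x) (f y) = mdist M x y)"

definition isometry_onto :: "'a metric \<Rightarrow> 'b metric \<Rightarrow> ('a \<Rightarrow> 'b) \<Rightarrow> bool" where
  "isometry_onto M N f \<longleftrightarrow> isometric_embedding M N f \<and> f ` mspace M = mspace N"

definition homogeneous_metric :: "'a metric \<Rightarrow> bool" where
  "homogeneous_metric M \<longleftrightarrow>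
     (\<forall>A B f. finite A \<and> A \<subseteq> mspace M \<and> B \<subseteq> mspace M \<and>
        isometry_onto (submetric M A) (submetric M B) f \<longrightarrow>
        (\<exists>g. isometry_onto M M g \<and> (\<forall>x \<in> A. g x = f x)))"

text \<open>
  One cannot quantify over types inside a definition, so the finite test spaces have their points
  in \<^typ>\<open>nat\<close>. Every finite metric space is isometric to one of these; the lemma
  \<open>universal_metric_embeds\<close> below recovers the property for finite spaces over any type.
\<close>

definition universal_metric :: "'a metric \<Rightarrow> bool" where
  "universal_metric M \<longleftrightarrow>
     (\<forall>F :: nat metric. finite (mspace F) \<and> dist_set F \<subseteq> dist_set M \<longrightarrow>
        (\<exists>f. isometric_embedding F M f))"

lemma universal_metric_embeds:
  fixes M :: "'a metric" and F :: "'b metric"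
  assumes univ: "universal_metric M" and fin: "finite (mspace F)"
    and sub: "dist_set F \<subseteq> dist_set M"
  shows "\<exists>f. isometric_embedding F M f"
proof -
  obtain h :: "'b \<Rightarrow> nat" where h: "inj_on h (mspace F)"
    using finite_imp_inj_to_nat_seg[OF fin] by blast
  define k where "k = inv_into (mspace F) h"
  have kh: "k (h x) = x" if "x \<in> mspace F" for x
    using that h by (simp add: k_def)
  interpret F: Metric_space "mspace F" "mdist F" by simp
  have ms: "Metric_space (h ` mspace F) (\<lambda>i j. mdist F (k i) (k j))"
    by unfold_locales (auto simp: kh F.commute intro: F.triangle)
  define G where "G = metric (h ` mspace F, \<lambda>i j. mdist F (k i) (k j))"
  have G: "mspace G = h ` mspace F" "mdist G = (\<lambda>i j. mdist F (k i) (k j))"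
    using ms by (simp_all add: G_def Metric_space.mspace_metric Metric_space.mdist_metric)
  have "dist_set G = dist_set F"
  proof (intro equalityI subsetI)
    fix r assume "r \<in> dist_set G"
    then show "r \<in> dist_set F" by (clarsimp simp: dist_set_def G kh) blast
  next
    fix r assume "r \<in> dist_set F"
    then obtain x y where "x \<in> mspace F" "y \<in> mspace F" "r = mdist F x y"
      by (auto simp: dist_set_def)
    then have "h x \<in> mspace G" "h y \<in> mspace G" "r = mdist G (h x) (h y)"
      by (simp_all add: G kh)
    then show "r \<in> dist_set G" unfolding dist_set_def by blast
  qed
  with sub have "dist_set G \<subseteq> dist_set M" by simp
  moreover have "finite (mspace G)" using fin by (simp add: G)
  ultimately obtain g where "isometric_embedding G M g"
    using univ unfolding universal_metric_def by blast
  then have "isometric_embedding F M (g \<circ> h)"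
    by (auto simp: isometric_embedding_def G kh)
  then show ?thesis by blast
qed

definition isometric_copy :: "'a metric \<Rightarrow> 'a set \<Rightarrow> bool" where
  "isometric_copy M S \<longleftrightarrow> S \<subseteq> mspace M \<and> (\<exists>f. isometry_onto M (submetric M S) f)"

text \<open>
  For nonempty \<open>M\<close> and bounded \<open>f\<close> the supremum is that of a nonempty bounded set of reals,
  hence not an unspecified value of \<^const>\<open>Sup\<close>.
\<close>

definition oscillation_stable :: "'a metric \<Rightarrow> bool" where
  "oscillation_stable M \<longleftrightarrow>
     (\<forall>\<epsilon>>0. \<forall>f :: 'a \<Rightarrow> real.
        uniformly_continuous_map M euclidean_metric f \<and> bounded (f ` mspace M) \<longrightarrow>
        (\<exists>S. isometric_copy M S \<and> Sup {\<bar>f x - f y\<bar> | x y. x \<in> S \<and> y \<in> S} < \<epsilon>))"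

end

theory Submission
  imports Defs
begin

text \<open>
  Let \<open>R\<close> be the set of distances of \<open>M\<close>; it is closed, has \<open>0\<close> as a limit point, and
  \<open>a \<oplus> b = max {r \<in> R. r \<le> a + b}\<close> is associative on it. For a small \<open>\<eta> \<in> R\<close> there is a finite set
  \<open>S \<subseteq> R\<close>, closed under \<open>\<oplus>\<close>, such that rounding distances up to \<open>S\<close> changes them by at most \<open>\<eta>\<close> and
  preserves triangles. Encode the \<open>n\<close>-th point of a countable metric space with distances in \<open>S\<close> by
  the word of its distances to the earlier points; the words over \<open>S\<close> carry a metric realising all
  these codes. A Gowers-type Ramsey theorem for words (proved with idempotent ultrafilters)
  yields, for every finite colouring of words, a substitution that preserves this metric and has
  monochromatic range. Applied to the rounding of a dense sequence of \<open>M\<close>, it gives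
  a sequence on which \<open>f\<close> is nearly constant but whose distances are off by up to \<open>\<eta>\<close>. To
  repair them, embed into \<open>M\<close> from the start an amalgam of the words with all exact corrections of
  such sequences, each correction lying within \<open>\<eta>\<close> of the sequence it corrects. Uniform continuity and
  completeness finish the proof.
\<close>

section \<open>Idempotent ultrafilters and a Ramsey theorem for words\<close>

text \<open>The Ramsey theorem needs a finite alphabet, which forces the rounding; the rounding
  loses the exact distances, which forces the corrections. The order of choices matters: the
  colouring reads \<open>f\<close> at embedded points, so the embedding into \<open>M\<close> is
  fixed before it is known which sequence becomes monochromatic. Hence corrections of all sequences
  are adjoined at once, indexed by their finite initial segments; over a finite alphabet these are
  countably many, so the amalgam can be placed in \<open>M\<close> point by point. In both amalgams
  the danger is a shortcut: a walk that undercuts a prescribed distance. It is excluded by functions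
  that change along each edge by at most its length. Walk lengths are \<oplus>-sums, which may be
  smaller than ordinary sums, and associativity of \<oplus> is what carries such bounds from edges
  to walks. Rounding goes upward because the correction argument uses that the approximate distances
  dominate the exact ones. Uncountability supplies arbitrarily small distances: without them a
  countable dense set would be all of \<open>M\<close>.\<close>

lemma Ellis_Numakura:
  fixes K :: "'a::t2_space set" and f :: "'a \<Rightarrow> 'a \<Rightarrow> 'a"
  assumes K: "compact K" "K \<noteq> {}"
    and cl: "\<And>x y. x \<in> K \<Longrightarrow> y \<in> K \<Longrightarrow> f x y \<in> K"
    and assoc: "\<And>x y z. x \<in> K \<Longrightarrow> y \<in> K \<Longrightarrow> z \<in> K \<Longrightarrow> f (f x y) z = f x (f y z)"
    and cont: "\<And>y. y \<in> K \<Longrightarrow> continuous_on K (\<lambda>x. f x y)"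
  shows "\<exists>e\<in>K. f e e = e"
proof -
  define \<C> where "\<C> = {P. P \<subseteq> K \<and> P \<noteq> {} \<and> closed P \<and> (\<forall>x\<in>P. \<forall>y\<in>P. f x y \<in> P)}"
  have "\<exists>P\<in>\<C>. \<forall>Q\<in>\<C>. Q \<subseteq> P \<longrightarrow> Q = P"
  proof -
    \<comment> \<open>Complements are taken because Zorn's lemma yields maximal sets, while a
      minimal closed subsemigroup is wanted.\<close>
    have "\<exists>m\<in>uminus ` \<C>. \<forall>x\<in>uminus ` \<C>. m \<subseteq> x \<longrightarrow> x = m"
    proof (rule subset_Zorn_nonempty)
      show "uminus ` \<C> \<noteq> {}"
      proof -
        have "K \<in> \<C>" using K cl compact_imp_closed[OF K(1)] by (simp add: \<C>_def)
        then show ?thesis by blast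
      qed
      fix \<D> assume ne: "\<D> \<noteq> {}" and ch: "subset.chain (uminus ` \<C>) \<D>"
      define \<E> where "\<E> = uminus ` \<D>"
      have E: "\<E> \<subseteq> \<C>" "\<E> \<noteq> {}" and chE: "\<And>P Q. P \<in> \<E> \<Longrightarrow> Q \<in> \<E> \<Longrightarrow> P \<subseteq> Q \<or> Q \<subseteq> P"
        using ne ch by (auto simp: \<E>_def subset.chain_def subset_iff)
      have "K \<inter> \<Inter>\<E> \<noteq> {}"
      proof (rule compact_imp_fip[OF K(1)])
        show "closed T" if "T \<in> \<E>" for T using that E by (auto simp: \<C>_def)
        show "K \<inter> \<Inter>F' \<noteq> {}" if "finite F'" "F' \<subseteq> \<E>" for F'
        proof (cases "F' = {}")
          case False
          have "\<Inter>F' \<in> F'"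
            using that(1) False that(2)
          proof (induction F' rule: finite_ne_induct)
            case (insert P F)
            then have "\<Inter>F \<in> F" "P \<subseteq> \<Inter>F \<or> \<Inter>F \<subseteq> P" using chE[of P "\<Inter>F"] by auto
            moreover have "\<Inter>(insert P F) = P \<inter> \<Inter>F" by simp
            ultimately show ?case by (metis Int_absorb1 Int_absorb2 insertCI)
          qed auto
          then have "\<Inter>F' \<in> \<C>" using that(2) E(1) by (meson subsetD)
          then show ?thesis by (simp add: \<C>_def Int_absorb1)
        qed (use K in auto)
      qed
      then have "\<Inter>\<E> \<in> \<C>"
      proof -
        assume "K \<inter> \<Inter>\<E> \<noteq> {}"
        moreover have "closed (\<Inter>\<E>)" using E by (intro closed_Inter) (auto simp: \<C>_def)
        moreover have "\<Inter>\<E> \<subseteq> K"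
        proof -
          obtain P where "P \<in> \<E>" using E(2) by blast
          moreover from this have "P \<subseteq> K" using E(1) by (auto simp: \<C>_def)
          ultimately show ?thesis by blast
        qed
        moreover have "f x y \<in> \<Inter>\<E>" if "x \<in> \<Inter>\<E>" "y \<in> \<Inter>\<E>" for x y
        proof
          fix P assume "P \<in> \<E>"
          moreover from this have "P \<in> \<C>" using E(1) by blast
          ultimately show "f x y \<in> P" using that by (simp add: \<C>_def)
        qed
        ultimately show ?thesis by (simp add: \<C>_def) blast
      qed
      then have "- \<Inter>\<E> \<in> uminus ` \<C>" by blast
      moreover have "- \<Inter>\<E> = \<Union>\<D>" by (auto simp: \<E>_def)
      ultimately show "\<Union>\<D> \<in> uminus ` \<C>" by simp
    qed
    then obtain P where P: "P \<in> \<C>" "\<forall>x\<in>uminus ` \<C>. - P \<subseteq> x \<longrightarrow> x = - P" by blast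
    have "Q = P" if "Q \<in> \<C>" "Q \<subseteq> P" for Q
      using P(2)[rule_format, of "- Q"] that by blast
    with P(1) show ?thesis by blast
  qed
  then obtain P where P: "P \<in> \<C>" and min: "\<And>Q. Q \<in> \<C> \<Longrightarrow> Q \<subseteq> P \<Longrightarrow> Q = P" by blast
  from P obtain e where e: "e \<in> P" by (auto simp: \<C>_def)
  have PK: "P \<subseteq> K" "closed P" and Pm: "\<And>x y. x \<in> P \<Longrightarrow> y \<in> P \<Longrightarrow> f x y \<in> P"
    using P by (auto simp: \<C>_def)
  have cP: "compact P" using PK K(1) by (metis compact_Int_closed inf.absorb2)
  have conte: "continuous_on P (\<lambda>x. f x e)"
    using cont e PK continuous_on_subset by blast
  \<comment> \<open>The left ideal \<open>P e\<close> is a closed subsemigroup inside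
    \<open>P\<close>; minimality makes it all of \<open>P\<close>, so some \<open>x0\<close> in
    \<open>P\<close> has \<open>x0 e = e\<close>.\<close>
  have "(\<lambda>x. f x e) ` P \<in> \<C>"
  proof -
    have "closed ((\<lambda>x. f x e) ` P)"
      by (intro compact_imp_closed compact_continuous_image conte cP)
    moreover have "f (f x e) (f y e) \<in> (\<lambda>x. f x e) ` P" if "x \<in> P" "y \<in> P" for x y
    proof -
      have "f (f x e) (f y e) = f (f (f x e) y) e"
        using that e PK Pm by (subst assoc) (auto simp: subset_iff)
      then show ?thesis using that e Pm by blast
    qed
    ultimately show ?thesis using e PK Pm cl by (auto simp: \<C>_def)
  qed
  then have "(\<lambda>x. f x e) ` P = P" using min Pm e by blast
  then obtain x0 where x0: "x0 \<in> P" "f x0 e = e" using e by (metis imageE)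
  \<comment> \<open>This stabiliser of \<open>e\<close> is nonempty by \<open>x0\<close> and closed
    by continuity; minimality again makes it \<open>P\<close>, so it contains \<open>e\<close>
    itself.\<close>
  define Q where "Q = {x\<in>P. f x e = e}"
  have "Q \<in> \<C>"
  proof -
    have "closed Q" unfolding Q_def
      using continuous_closed_preimage_constant[OF conte PK(2)] by simp
    moreover have "f x y \<in> Q" if "x \<in> Q" "y \<in> Q" for x y
      using that e PK Pm assoc[of x y e] by (auto simp: Q_def subset_iff)
    ultimately show ?thesis using x0 PK by (auto simp: \<C>_def Q_def)
  qed
  then have "Q = P" using min by (auto simp: Q_def)
  then have "f e e = e" using e by (auto simp: Q_def)
  with e PK show ?thesis by blast
qed

section \<open>Separation axioms for the product topology\<close>

lemma open_coordinate_vimage: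
  "open W \<Longrightarrow> open ((\<lambda>h :: 'a \<Rightarrow> 'b::topological_space. h i) -` W)"
  by (rule open_vimage[OF _ continuous_on_product_coordinates])

text \<open>\<open>Ellis_Numakura\<close> is stated for a Hausdorff type; this and the next two
  instances provide it for characteristic functions of families of sets.\<close>

instance "fun" :: (type, t0_space) t0_space
proof
  fix f g :: "'a \<Rightarrow> 'b" assume "f \<noteq> g"
  then obtain i where i: "f i \<noteq> g i" by (auto simp: fun_eq_iff)
  then obtain U where "open U" "\<not> (f i \<in> U \<longleftrightarrow> g i \<in> U)"
    using t0_space_class.t0_space[OF i] by blast
  then show "\<exists>U. open U \<and> \<not> (f \<in> U \<longleftrightarrow> g \<in> U)"
    by (intro exI[of _ "(\<lambda>h. h i) -` U"]) (simp add: open_coordinate_vimage)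
qed

instance "fun" :: (type, t1_space) t1_space
proof
  fix f g :: "'a \<Rightarrow> 'b" assume "f \<noteq> g"
  then obtain i where i: "f i \<noteq> g i" by (auto simp: fun_eq_iff)
  then obtain U where "open U" "f i \<in> U" "g i \<notin> U"
    using t1_space_class.t1_space[OF i] by blast
  then show "\<exists>U. open U \<and> f \<in> U \<and> g \<notin> U"
    by (intro exI[of _ "(\<lambda>h. h i) -` U"]) (simp add: open_coordinate_vimage)
qed

instance "fun" :: (type, t2_space) t2_space
proof
  fix f g :: "'a \<Rightarrow> 'b" assume "f \<noteq> g"
  then obtain i where i: "f i \<noteq> g i" by (auto simp: fun_eq_iff)
  then obtain U V where UV: "open U" "open V" "f i \<in> U" "g i \<in> V" "U \<inter> V = {}"
    using hausdorff[OF i] by blast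
  show "\<exists>U V. open U \<and> open V \<and> f \<in> U \<and> g \<in> V \<and> U \<inter> V = {}"
    by (intro exI[of _ "(\<lambda>h. h i) -` U"] exI[of _ "(\<lambda>h. h i) -` V"])
      (use UV in \<open>auto simp: open_coordinate_vimage\<close>)
qed

text \<open>Ultrafilters are encoded as characteristic functions on sets, so that they inherit the compact
  product topology of \<open>'x set \<Rightarrow> bool\<close>.\<close>

definition ultra :: "('x set \<Rightarrow> bool) \<Rightarrow> bool" where
  "ultra p \<longleftrightarrow> p UNIV \<and> (\<forall>A. p (- A) \<longleftrightarrow> \<not> p A) \<and> (\<forall>A B. p A \<longrightarrow> p B \<longrightarrow> p (A \<inter> B))"

lemma ultra_mono: "ultra p \<Longrightarrow> p A \<Longrightarrow> A \<subseteq> B \<Longrightarrow> p B"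
proof (rule ccontr)
  assume p: "ultra p" "p A" "A \<subseteq> B" "\<not> p B"
  then have "p (A \<inter> - B)" unfolding ultra_def by blast
  moreover have "A \<inter> - B = - UNIV" using p by auto
  ultimately show False using p(1) unfolding ultra_def by metis
qed

lemma ultra_Int: "ultra p \<Longrightarrow> p (A \<inter> B) \<longleftrightarrow> p A \<and> p B"
  using ultra_mono[of p "A \<inter> B" A] ultra_mono[of p "A \<inter> B" B] unfolding ultra_def by blast

lemma ultra_Compl: "ultra p \<Longrightarrow> p (- A) \<longleftrightarrow> \<not> p A"
  by (simp add: ultra_def)

lemma ultra_UNIV: "ultra p \<Longrightarrow> p UNIV"
  by (simp add: ultra_def)

lemma ultra_nonempty: "ultra p \<Longrightarrow> p A \<Longrightarrow> A \<noteq> {}"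
  using ultra_Compl[of p UNIV] ultra_UNIV[of p] by (metis Compl_UNIV_eq)

lemma ultra_INT:
  assumes "ultra p" "finite I" "\<And>i. i \<in> I \<Longrightarrow> p (A i)"
  shows "p (\<Inter>i\<in>I. A i)"
  using assms(2,3) by (induction I rule: finite_induct) (simp_all add: assms(1) ultra_UNIV ultra_Int)

lemma ultra_Un: "ultra p \<Longrightarrow> p (A \<union> B) \<longleftrightarrow> p A \<or> p B"
  using ultra_Int[of p "- A" "- B"] ultra_Compl[of p] by (metis Compl_Un double_complement)

lemma ultra_UN:
  assumes "ultra p" "finite I" "p (\<Union>i\<in>I. A i)"
  shows "\<exists>i\<in>I. p (A i)"
  using assms(2,3)
proof (induction I rule: finite_induct)
  case empty
  then show ?case using ultra_nonempty[OF assms(1), of "{}"] by simp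
next
  case (insert x F)
  then show ?case using ultra_Un[OF assms(1), of "A x" "\<Union>i\<in>F. A i"] by auto
qed

lemma ultra_principal: "ultra (\<lambda>A. x \<in> A)"
  by (auto simp: ultra_def)

text \<open>The condition factors through a continuous map into a finite discrete space. Three
  coordinates are enough for each axiom of \<open>ultra\<close>.\<close>

lemma closed_coord: "closed {p :: 'x set \<Rightarrow> bool. P (p A) (p B) (p C)}"
proof -
  have "closed ((\<lambda>p :: 'x set \<Rightarrow> bool. (p A, p B, p C)) -` {(a, b, c). P a b c})"
  proof (rule closed_vimage)
    show "closed {(a, b, c). P a b c}" by (rule finite_imp_closed) (rule finite)
    show "continuous_on UNIV (\<lambda>p :: 'x set \<Rightarrow> bool. (p A, p B, p C))"
      by (intro continuous_on_Pair continuous_on_product_coordinates)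
  qed
  then show ?thesis by (simp add: vimage_def)
qed

section \<open>Compactness of the space of ultrafilters\<close>

lemma compact_UNIV_bool_fun: "compact (UNIV :: ('x \<Rightarrow> bool) set)"
proof -
  have "compact_space (euclidean :: bool topology)"
    by (simp add: compact_space_def finite_imp_compact)
  then have "compact_space (product_topology (\<lambda>i::'x. euclidean :: bool topology) UNIV)"
    by (simp add: compact_space_product_topology)
  then show ?thesis
    by (simp add: euclidean_product_topology compact_space_def)
qed

lemma closed_ultra: "closed {p :: 'a set \<Rightarrow> bool. ultra p}"
proof -
  have c1: "closed {p :: 'a set \<Rightarrow> bool. p UNIV}"
    by (rule closed_coord[of "\<lambda>a b c. a" UNIV UNIV UNIV])
  have c2: "closed {p :: 'a set \<Rightarrow> bool. p (- A) \<longleftrightarrow> \<not> p A}" for A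
    by (rule closed_coord[of "\<lambda>a b c. a \<longleftrightarrow> \<not> b" "- A" A A])
  have c3: "closed {p :: 'a set \<Rightarrow> bool. p A \<longrightarrow> p B \<longrightarrow> p (A \<inter> B)}" for A B
    by (rule closed_coord[of "\<lambda>a b c. a \<longrightarrow> b \<longrightarrow> c" A B "A \<inter> B"])
  have "{p :: 'a set \<Rightarrow> bool. ultra p} = {p. p UNIV} \<inter> (\<Inter>A. {p. p (- A) \<longleftrightarrow> \<not> p A}) \<inter>
     (\<Inter>A. \<Inter>B. {p. p A \<longrightarrow> p B \<longrightarrow> p (A \<inter> B)})"
    by (auto simp: ultra_def)
  also have "closed \<dots>"
    using c1 c2 c3 by (intro closed_Int closed_INT ballI) blast+
  finally show ?thesis .
qed

text \<open>Compactness reduces the claim to finite subfamilies, and for these the principal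
  ultrafilter at a common point works.\<close>

lemma ultra_extend:
  assumes fip: "\<And>\<G>. finite \<G> \<Longrightarrow> \<G> \<subseteq> \<F> \<Longrightarrow> \<Inter>\<G> \<noteq> {}"
  shows "\<exists>p. ultra p \<and> (\<forall>A\<in>\<F>. p A)"
proof -
  have c: "compact {p :: 'a set \<Rightarrow> bool. ultra p}"
    using compact_Int_closed[OF compact_UNIV_bool_fun closed_ultra] by simp
  have "{p. ultra p} \<inter> \<Inter>((\<lambda>A. {p. p A}) ` \<F>) \<noteq> {}"
  proof (rule compact_imp_fip[OF c])
    fix T assume "T \<in> (\<lambda>A. {p. p A}) ` \<F>"
    then obtain A where "T = {p. p A}" by blast
    then show "closed T" using closed_coord[of "\<lambda>a b c. a" A A A] by simp
  next
    fix F' assume "finite F'" "F' \<subseteq> (\<lambda>A. {p :: 'a set \<Rightarrow> bool. p A}) ` \<F>"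
    then obtain \<G> where G: "finite \<G>" "\<G> \<subseteq> \<F>" "F' = (\<lambda>A. {p. p A}) ` \<G>"
      by (meson finite_subset_image)
    then obtain x where "x \<in> \<Inter>\<G>" using fip by blast
    then have "(\<lambda>A. x \<in> A) \<in> {p. ultra p} \<inter> \<Inter>F'"
      using G ultra_principal[of x] by simp
    then show "{p. ultra p} \<inter> \<Inter>F' \<noteq> {}" by blast
  qed
  then show ?thesis by auto
qed

text \<open>The product of ultrafilters that extends concatenation: for \<open>p\<close>-most
  \<open>x\<close> and then \<open>q\<close>-most \<open>y\<close>, the word \<open>x @ y\<close>
  lies in \<open>A\<close>. With this order of quantifiers it is continuous in
  \<open>p\<close>.\<close>

definition uconv :: "('x list set \<Rightarrow> bool) \<Rightarrow> ('x list set \<Rightarrow> bool) \<Rightarrow> 'x list set \<Rightarrow> bool"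
  where "uconv p q A \<longleftrightarrow> p {x. q {y. x @ y \<in> A}}"

definition umap :: "('x \<Rightarrow> 'y) \<Rightarrow> ('x set \<Rightarrow> bool) \<Rightarrow> 'y set \<Rightarrow> bool"
  where "umap h p A \<longleftrightarrow> p (h -` A)"

lemma ultra_uconv:
  assumes p: "ultra p" and q: "ultra q"
  shows "ultra (uconv p q)"
proof -
  have "uconv p q (- A) \<longleftrightarrow> \<not> uconv p q A" for A
  proof -
    have "{y. x @ y \<in> - A} = - {y. x @ y \<in> A}" for x by auto
    then have "{x. q {y. x @ y \<in> - A}} = - {x. q {y. x @ y \<in> A}}"
      by (simp only: ultra_Compl[OF q] Collect_neg_eq)
    then show ?thesis unfolding uconv_def by (simp only: ultra_Compl[OF p])
  qed
  moreover have "uconv p q (A \<inter> B)" if "uconv p q A" "uconv p q B" for A B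
  proof -
    have "{y. x @ y \<in> A \<inter> B} = {y. x @ y \<in> A} \<inter> {y. x @ y \<in> B}" for x by auto
    then have "{x. q {y. x @ y \<in> A \<inter> B}} = {x. q {y. x @ y \<in> A}} \<inter> {x. q {y. x @ y \<in> B}}"
      by (simp only: ultra_Int[OF q] Collect_conj_eq)
    then show ?thesis using that unfolding uconv_def by (simp only: ultra_Int[OF p])
  qed
  moreover have "uconv p q UNIV"
    by (simp add: uconv_def ultra_UNIV[OF p] ultra_UNIV[OF q])
  ultimately show ?thesis unfolding ultra_def[of "uconv p q"] by blast
qed

lemma uconv_assoc: "uconv (uconv p q) r = uconv p (uconv q r)"
  by (auto simp: uconv_def fun_eq_iff)

lemma umap_uconv: "umap (map h) (uconv p q) = uconv (umap (map h) p) (umap (map h) q)"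
  by (auto simp: umap_def uconv_def fun_eq_iff vimage_def)

lemma umap_cong: "ultra p \<Longrightarrow> p A \<Longrightarrow> (\<And>x. x \<in> A \<Longrightarrow> h x = x) \<Longrightarrow> umap h p = p"
proof
  fix B assume p: "ultra p" "p A" "\<And>x. x \<in> A \<Longrightarrow> h x = x"
  have "p (h -` B) \<longleftrightarrow> p (A \<inter> h -` B)" using p by (simp add: ultra_Int)
  also have "A \<inter> h -` B = A \<inter> B" using p by auto
  also have "p \<dots> \<longleftrightarrow> p B" using p by (simp add: ultra_Int)
  finally show "umap h p B = p B" by (simp add: umap_def)
qed

lemma continuous_uconv_left: "continuous_on K (\<lambda>p. uconv p q)"
  unfolding uconv_def
  by (intro continuous_on_coordinatewise_then_product)
     (rule continuous_on_subset[OF continuous_on_product_coordinates], simp)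

lemma uconv_idempotent:
  assumes "closed K" "K \<noteq> {}" "\<And>p. p \<in> K \<Longrightarrow> ultra p"
    "\<And>p q. p \<in> K \<Longrightarrow> q \<in> K \<Longrightarrow> uconv p q \<in> K"
  shows "\<exists>e\<in>K. uconv e e = e"
proof (rule Ellis_Numakura[where f = uconv])
  show "compact K" using compact_Int_closed[OF compact_UNIV_bool_fun assms(1)] by simp
  show "K \<noteq> {}" by fact
  show "uconv x y \<in> K" if "x \<in> K" "y \<in> K" for x y using that by (rule assms(4))
  show "uconv (uconv x y) z = uconv x (uconv y z)" for x y z by (rule uconv_assoc)
  show "continuous_on K (\<lambda>x. uconv x y)" for y by (rule continuous_uconv_left)
qed

lemma uconv_memI:
  assumes p: "ultra p" "p X" and q: "ultra q" "q Y"
    and XY: "\<And>x y. x \<in> X \<Longrightarrow> y \<in> Y \<Longrightarrow> x @ y \<in> Z"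
  shows "uconv p q Z"
proof -
  have "X \<subseteq> {x. q {y. x @ y \<in> Z}}"
    using XY by (auto intro!: ultra_mono[OF q])
  then show ?thesis unfolding uconv_def using ultra_mono[OF p] by blast
qed

lemma closed_eval: "closed {q :: 'x set \<Rightarrow> bool. q X}"
  using closed_coord[of "\<lambda>a b c. a" X X X] .

lemma closed_umap_eq: "closed {q :: 'x set \<Rightarrow> bool. umap h q = p}"
proof -
  have "{q :: 'x set \<Rightarrow> bool. umap h q = p} = (\<Inter>B. {q. q (h -` B) = p B})"
    by (auto simp: umap_def fun_eq_iff)
  also have "closed \<dots>"
    by (intro closed_INT ballI closed_coord[of "\<lambda>a b c. a = p B" "h -` B" "h -` B" "h -` B" for B])
  finally show ?thesis .
qed

lemma umap_umap: "umap f (umap g p) = umap (f \<circ> g) p"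
  by (simp add: umap_def fun_eq_iff vimage_comp)

lemma ultra_lift:
  assumes p: "ultra p" and sur: "\<And>B. p B \<Longrightarrow> \<exists>x\<in>X. h x \<in> B"
  shows "\<exists>q. ultra q \<and> q X \<and> umap h q = p"
proof -
  have "\<exists>q. ultra q \<and> (\<forall>A\<in>{X \<inter> h -` B |B. p B}. q A)"
  proof (rule ultra_extend)
    fix \<G> assume G: "finite \<G>" "\<G> \<subseteq> {X \<inter> h -` B |B. p B}"
    have "\<forall>A\<in>\<G>. \<exists>B. p B \<and> A = X \<inter> h -` B" using G(2) by blast
    then obtain \<beta> where \<beta>: "\<And>A. A \<in> \<G> \<Longrightarrow> p (\<beta> A)" "\<And>A. A \<in> \<G> \<Longrightarrow> A = X \<inter> h -` \<beta> A"
      by metis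
    have "p (\<Inter>A\<in>\<G>. \<beta> A)" using ultra_INT[OF p G(1)] \<beta>(1) by blast
    then obtain x where "x \<in> X" "h x \<in> (\<Inter>A\<in>\<G>. \<beta> A)" using sur by blast
    then have "x \<in> A" if "A \<in> \<G>" for A using \<beta>(2)[OF that] that by blast
    then show "\<Inter>\<G> \<noteq> {}" by blast
  qed
  then obtain q where q: "ultra q" "\<And>B. p B \<Longrightarrow> q (X \<inter> h -` B)" by blast
  have "umap h q B = p B" for B
  proof (cases "p B")
    case True
    then show ?thesis using q(2)[of B] ultra_Int[OF q(1)] by (simp add: umap_def)
  next
    case False
    then have "q (h -` (- B))" using q(2)[of "- B"] ultra_Int[OF q(1)] ultra_Compl[OF p] by blast
    then show ?thesis using False ultra_Compl[OF q(1), of "h -` B"]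
      by (simp add: umap_def vimage_Compl)
  qed
  moreover have "q X" using q(2)[OF ultra_UNIV[OF p]] by simp
  ultimately show ?thesis using q(1) by blast
qed

text \<open>Going down the chain, an ultrafilter \<open>p\<close> on words over the larger letters is lifted along
  \<open>map (max m)\<close>; with \<open>r\<close> an idempotent in the left ideal of lifts \<open>q \<cdot> p\<close>, the product \<open>p \<cdot> r\<close>
  satisfies the equations for the old letters and for the new one.\<close>

lemma chain_ultrafilter:
  fixes K :: "'a::linorder set"
  assumes "finite K" "K \<noteq> {}"
  shows "\<exists>p. ultra p \<and> p {v. set v \<subseteq> K \<and> Min K \<in> set v} \<and>
    (\<forall>a\<in>K. uconv (umap (map (max a)) p) p = p)"
  using assms
proof (induction K rule: finite_linorder_min_induct)
  case (insert b A)
  define X where "X = {v. set v \<subseteq> insert b A \<and> b \<in> set v}"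
  have Min: "Min (insert b A) = b"
    using insert.hyps by (intro Min_eqI) (auto simp: less_imp_le)
  have idX: "map (max b) v = v" if "v \<in> X" for v
  proof (rule map_idI)
    fix x assume "x \<in> set v"
    then have "x = b \<or> b < x" using that insert.hyps by (auto simp: X_def)
    then show "max b x = x" by auto
  qed
  show ?case
  proof (cases "A = {}")
    case True
    define K0 where "K0 = {q. ultra q} \<inter> {q. q X}"
    have "\<exists>e\<in>K0. uconv e e = e"
    proof (rule uconv_idempotent)
      show "closed K0" unfolding K0_def by (intro closed_Int closed_ultra closed_eval)
      have "(\<lambda>B. [b] \<in> B) \<in> K0" by (simp add: K0_def ultra_principal X_def)
      then show "K0 \<noteq> {}" by blast
      show "ultra q" if "q \<in> K0" for q using that by (simp add: K0_def)
      show "uconv q q' \<in> K0" if "q \<in> K0" "q' \<in> K0" for q q'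
      proof -
        have "uconv q q' X"
          by (rule uconv_memI[of q X q' X]) (use that in \<open>auto simp: K0_def X_def\<close>)
        then show ?thesis using that by (simp add: K0_def ultra_uconv)
      qed
    qed
    then obtain e where e: "ultra e" "e X" "uconv e e = e" by (auto simp: K0_def)
    have "umap (map (max b)) e = e" using umap_cong[OF e(1,2)] idX by blast
    then show ?thesis unfolding Min using e True by (intro exI[of _ e]) (simp add: X_def)
  next
    case False
    define m where "m = Min A"
    define h where "h = map (max m)"
    define Y where "Y = {v. set v \<subseteq> A \<and> m \<in> set v}"
    obtain p where p: "ultra p" "p Y" and pa: "\<And>a. a \<in> A \<Longrightarrow> uconv (umap (map (max a)) p) p = p"
      using insert.IH[OF False] by (auto simp: m_def Y_def)
    have mA: "m \<in> A" "\<And>a. a \<in> A \<Longrightarrow> m \<le> a" using False insert.hyps(1) by (auto simp: m_def)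
    have bm: "b < m" using mA insert.hyps by blast
    have hp: "umap h p = p"
    proof (rule umap_cong[OF p])
      fix v assume "v \<in> Y"
      then show "h v = v" unfolding h_def using mA(2) by (intro map_idI) (auto simp: Y_def max_absorb2)
    qed
    have pp: "uconv p p = p" using pa[OF mA(1)] hp by (simp add: h_def)
    define T where "T = {q. ultra q} \<inter> {q. q X} \<inter> {q. umap h q = p}"
    have Tprod: "uconv q q' \<in> T" if "q \<in> T" "q' \<in> T" for q q'
    proof -
      have "uconv q q' X"
        by (rule uconv_memI[of q X q' X]) (use that in \<open>auto simp: T_def X_def\<close>)
      then show ?thesis using that by (simp add: T_def ultra_uconv h_def umap_uconv pp[unfolded h_def])
    qed
    have Tp1: "uconv q p \<in> T" if "q \<in> T" for q
    proof -
      have "uconv q p X"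
        by (rule uconv_memI[of q X p Y]) (use that p in \<open>auto simp: T_def X_def Y_def\<close>)
      then show ?thesis using that p hp by (simp add: T_def ultra_uconv h_def umap_uconv pp[unfolded h_def])
    qed
    have Tp2: "uconv p q \<in> T" if "q \<in> T" for q
    proof -
      have "uconv p q X"
        by (rule uconv_memI[of p Y q X]) (use that p in \<open>auto simp: T_def X_def Y_def\<close>)
      then show ?thesis using that p hp by (simp add: T_def ultra_uconv h_def umap_uconv pp[unfolded h_def])
    qed
    \<comment> \<open>The idempotent is sought among the products ending in \<open>p\<close> rather
      than in all of \<open>T\<close>; since \<open>p\<close> is idempotent, this yields
      \<open>r p = r\<close>.\<close>
    have "\<exists>r\<in>(\<lambda>q. uconv q p) ` T. uconv r r = r"
    proof (rule uconv_idempotent)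
      have "closed T" unfolding T_def by (intro closed_Int closed_ultra closed_eval closed_umap_eq)
      then have "compact T" using compact_Int_closed[OF compact_UNIV_bool_fun] by auto
      then show "closed ((\<lambda>q. uconv q p) ` T)"
        by (intro compact_imp_closed compact_continuous_image continuous_uconv_left)
      have "\<exists>q. ultra q \<and> q X \<and> umap h q = p"
      proof (rule ultra_lift[OF p(1)])
        fix B assume "p B"
        then have "p (B \<inter> Y)" using p ultra_Int by blast
        then obtain v where v: "v \<in> B" "v \<in> Y" using ultra_nonempty[OF p(1)] by blast
        \<comment> \<open>Replacing \<open>m\<close> by \<open>b\<close> is a right inverse of
          \<open>map (max m)\<close> on \<open>Y\<close>, and it makes the new letter occur.\<close>
        define w where "w = map (\<lambda>x. if x = m then b else x) v"
        have "h w = v" unfolding w_def h_def map_map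
          by (rule map_idI) (use v bm mA(2) in \<open>auto simp: Y_def max_def\<close>)
        moreover have "w \<in> X" using v by (auto simp: w_def X_def Y_def)
        ultimately show "\<exists>x\<in>X. h x \<in> B" using v by metis
      qed
      then show "(\<lambda>q. uconv q p) ` T \<noteq> {}" by (auto simp: T_def)
      show "ultra q" if "q \<in> (\<lambda>q. uconv q p) ` T" for q
        using that p by (auto simp: T_def ultra_uconv)
      show "uconv x y \<in> (\<lambda>q. uconv q p) ` T" if xy: "x \<in> (\<lambda>q. uconv q p) ` T" "y \<in> (\<lambda>q. uconv q p) ` T" for x y
      proof -
        obtain q q' where q: "q \<in> T" "x = uconv q p" "q' \<in> T" "y = uconv q' p" using xy by blast
        then have "uconv x y = uconv (uconv (uconv q p) q') p" by (simp add: uconv_assoc)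
        moreover have "uconv (uconv q p) q' \<in> T" using q Tprod Tp1 by blast
        ultimately show ?thesis by blast
      qed
    qed
    then obtain q where q: "q \<in> T" "uconv (uconv q p) (uconv q p) = uconv q p" by blast
    define r where "r = uconv q p"
    have r: "r \<in> T" "uconv r r = r" "uconv r p = r"
      using q Tp1 by (simp_all add: r_def uconv_assoc pp)
    \<comment> \<open>Then \<open>p p' = p'\<close> since \<open>p p = p\<close>, and
      \<open>p' p' = p (r p) r = p r r = p'\<close>.\<close>
    define p' where "p' = uconv p r"
    have p': "p' \<in> T" "uconv p p' = p'" "uconv p' p' = p'"
      using r Tp2 by (auto simp: p'_def uconv_assoc[symmetric] pp) (metis r(2,3) uconv_assoc)
    have "uconv (umap (map (max a)) p') p' = p'" if "a \<in> insert b A" for a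
    proof (cases "a = b")
      case True
      have "umap (map (max b)) p' = p'"
        using p'(1) idX by (intro umap_cong[of p' X]) (auto simp: T_def)
      then show ?thesis using True p' by simp
    next
      case False
      then have a: "a \<in> A" using that by blast
      \<comment> \<open>Levels \<open>a \<ge> m\<close> cannot distinguish \<open>p'\<close> from
        its image \<open>p\<close>, so the old equations carry over.\<close>
      have "map (max a) = map (max a) \<circ> h"
        using mA(2)[OF a] by (auto simp: h_def fun_eq_iff max_def)
      then have "umap (map (max a)) p' = umap (map (max a)) p"
        using p'(1) umap_umap[of "map (max a)" h p'] by (simp add: T_def)
      then show ?thesis using pa[OF a] p'(2) by (metis uconv_assoc)
    qed
    then show ?thesis unfolding Min using p'(1) by (intro exI[of _ p']) (auto simp: T_def X_def)
  qed
qed simp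

text \<open>The word \<open>w\<close> is substituted into the blocks \<open>b\<close>, whose zeros act as variables: block \<open>i\<close> is
  raised to the level \<open>w ! i\<close>, and the word stops at the first variable of the next block.\<close>

definition word_prefix :: "(nat \<Rightarrow> real list) \<Rightarrow> real list \<Rightarrow> real list" where
  "word_prefix b w = concat (map (\<lambda>i. map (max (w ! i)) (b i)) [0..<length w])"

definition word_subst :: "(nat \<Rightarrow> real list) \<Rightarrow> real list \<Rightarrow> real list" where
  "word_subst b w = word_prefix b w @ takeWhile (\<lambda>x. x \<noteq> 0) (b (length w))"

lemma word_prefix_snoc:
  "word_prefix b (w @ [a]) = word_prefix b w @ map (max a) (b (length w))"
proof -
  have "map (\<lambda>i. map (max ((w @ [a]) ! i)) (b i)) [0..<length w] =
      map (\<lambda>i. map (max (w ! i)) (b i)) [0..<length w]"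
    by (rule map_cong) (auto simp: nth_append)
  moreover have "word_prefix b (w @ [a]) =
      concat (map (\<lambda>i. map (max ((w @ [a]) ! i)) (b i)) [0..<length w]) @ map (max a) (b (length w))"
    by (simp add: word_prefix_def)
  ultimately show ?thesis by (simp only: word_prefix_def)
qed

lemma word_prefix_cong:
  "(\<And>i. i < length w \<Longrightarrow> b i = b' i) \<Longrightarrow> word_prefix b w = word_prefix b' w"
  unfolding word_prefix_def by (intro arg_cong[of _ _ concat] map_cong) auto

text \<open>Blocks are chosen successively so that, for each word \<open>w\<close> over
  \<open>S\<close> of the current length, the set of continuations of \<open>word_prefix b w\<close>
  into \<open>A\<close> stays in \<open>p\<close>. There are finitely many words of each length, so
  a new block has to meet only finitely many conditions, each holding on a set of
  \<open>p\<close>.\<close>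

theorem word_Ramsey:
  fixes S :: "real set" and col :: "real list \<Rightarrow> 'c"
  assumes S: "finite S" "\<And>s. s \<in> S \<Longrightarrow> 0 < s"
    and fin: "finite (range col)"
  shows "\<exists>b k. (\<forall>n. set (b n) \<subseteq> insert 0 S \<and> 0 \<in> set (b n)) \<and>
    (\<forall>w. set w \<subseteq> S \<longrightarrow> col (word_subst b w) = k)"
proof -
  define K where "K = insert 0 S"
  have K: "finite K" "K \<noteq> {}" using S by (auto simp: K_def)
  have "Min K = 0" unfolding K_def by (rule Min_eqI) (use S in \<open>auto intro: less_imp_le\<close>)
  note K = K this
  obtain p where p: "ultra p" "p {v. set v \<subseteq> K \<and> 0 \<in> set v}"
    and pa: "\<And>a. a \<in> K \<Longrightarrow> uconv (umap (map (max a)) p) p = p"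
    using chain_ultrafilter[OF K(1,2)] K(3) by auto
  define X where "X = {v. set v \<subseteq> K \<and> 0 \<in> set v}"
  let ?tw = "takeWhile (\<lambda>x::real. x \<noteq> 0)"
  \<comment> \<open>Words are coloured by their part before the first variable, because a
    substituted word is cut there.\<close>
  have "p (\<Union>k\<in>range col. {v. col (?tw v) = k})"
    using ultra_UNIV[OF p(1)] by (rule ultra_mono[OF p(1)]) auto
  then obtain k where k: "p {v. col (?tw v) = k}" using ultra_UN[OF p(1) fin] by blast
  define A where "A = {v. col (?tw v) = k}"
  define P where "P b n r \<longleftrightarrow> r \<in> X \<and>
     (\<forall>w. set w \<subseteq> S \<and> length w = n \<longrightarrow> word_prefix b w @ r \<in> A \<and>
        (\<forall>a\<in>S. p {x. (word_prefix b w @ map (max a) r) @ x \<in> A}))" for b and n :: nat and r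
  have "\<exists>b. \<forall>n. P b n (b n)"
  proof (rule dependent_wellorder_choice)
    fix r :: "real list" and b b' :: "nat \<Rightarrow> real list" and n :: nat
    assume "\<And>y. y < n \<Longrightarrow> b y = b' y"
    then have eq: "word_prefix b w = word_prefix b' w" if "length w = n" for w
      using word_prefix_cong[of w b b'] that by simp
    show "P b n r = P b' n r" unfolding P_def by (auto simp: eq)
  next
    fix n :: nat and b :: "nat \<Rightarrow> real list"
    assume IH: "\<And>y. y < n \<Longrightarrow> P b y (b y)"
    define W where "W = {w. set w \<subseteq> S \<and> length w = n}"
    have finW: "finite W" unfolding W_def using finite_lists_length_eq[OF S(1)] .
    have base: "p {x. word_prefix b w @ x \<in> A}" if w: "w \<in> W" for w
    proof (cases n)
      case 0
      then show ?thesis using w k by (simp add: W_def word_prefix_def A_def)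
    next
      case (Suc n')
      then obtain w' a where wa: "w = w' @ [a]" "length w' = n'"
        using w by (cases w rule: rev_cases) (auto simp: W_def)
      have "P b n' (b n')" using IH Suc by simp
      then have "p {x. (word_prefix b w' @ map (max a) (b n')) @ x \<in> A}"
        using wa w unfolding P_def W_def by auto
      then show ?thesis by (simp add: wa word_prefix_snoc)
    qed
    \<comment> \<open>This is the equation for level \<open>a\<close> read backwards: a
      \<open>p\<close>-large set of continuations is also one for the product whose first factor is
      raised to \<open>a\<close>.\<close>
    have step: "p {r. p {x. (word_prefix b w @ map (max a) r) @ x \<in> A}}" if w: "w \<in> W" and a: "a \<in> S" for w a
    proof -
      have "uconv (umap (map (max a)) p) p {x. word_prefix b w @ x \<in> A}"
        using base[OF w] pa[of a] a by (simp add: K_def)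
      then show ?thesis by (simp add: uconv_def umap_def vimage_def)
    qed
    have "p (X \<inter> (\<Inter>w\<in>W. {r. word_prefix b w @ r \<in> A} \<inter>
       (\<Inter>a\<in>S. {r. p {x. (word_prefix b w @ map (max a) r) @ x \<in> A}})))" (is "p ?I")
      using p base step finW S(1)
      by (simp add: X_def ultra_Int ultra_INT)
    then obtain r where "r \<in> ?I" using ultra_nonempty[OF p(1)] by blast
    then have "P b n r" unfolding P_def W_def by blast
    then show "\<exists>r. P b n r" by blast
  qed
  then obtain b where b: "\<And>n. P b n (b n)" by blast
  have bX: "b n \<in> X" for n using b[of n] by (simp add: P_def)
  have "col (word_subst b w) = k" if w: "set w \<subseteq> S" for w
  proof -
    \<comment> \<open>Levels are positive, so every raised block is free of zeros and the first zero
      lies in the next, unraised block.\<close>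
    have pos: "x \<noteq> 0" if x: "x \<in> set (word_prefix b w)" for x
    proof -
      obtain i y where iy: "i < length w" "x = max (w ! i) y" using x by (auto simp: word_prefix_def)
      then have "0 < w ! i" using w S(2) by (meson nth_mem subsetD)
      then show ?thesis using iy by (auto simp: max_def)
    qed
    have "word_prefix b w @ b (length w) \<in> A" using b[of "length w"] w by (simp add: P_def)
    moreover have "?tw (word_prefix b w @ b (length w)) = word_subst b w"
      using pos by (simp add: takeWhile_append2 word_subst_def)
    ultimately show ?thesis by (simp add: A_def)
  qed
  then show ?thesis using bX by (intro exI[of _ b] exI[of _ k]) (auto simp: X_def K_def)
qed

section \<open>Sets of distances and walk distances\<close>

text \<open>The assumption \<open>amalg\<close> is half of the associativity of \<open>\<oplus>\<close>, which is the amalgamation property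
  for finite metric spaces with distances in \<open>R\<close>.\<close>

locale distance_set =
  fixes R :: "real set"
  assumes closed_R: "closed R" and zero_R: "0 \<in> R" and nonneg_R: "\<And>r. r \<in> R \<Longrightarrow> 0 \<le> r"
    and bdd_R: "bdd_above R"
    and amalg: "\<And>a b c. a \<in> R \<Longrightarrow> b \<in> R \<Longrightarrow> c \<in> R \<Longrightarrow>
      Sup {r \<in> R. r \<le> Sup {r \<in> R. r \<le> a + b} + c} \<le> a + Sup {r \<in> R. r \<le> b + c}"
begin

definition oplus :: "real \<Rightarrow> real \<Rightarrow> real" (infixl "\<oplus>" 65)
  where "a \<oplus> b = Sup {r \<in> R. r \<le> a + b}"

lemma oplus_in_le:
  assumes "a \<in> R" "b \<in> R"
  shows oplus_in: "a \<oplus> b \<in> R" and oplus_le: "a \<oplus> b \<le> a + b"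
proof -
  have "{r \<in> R. r \<le> a + b} = R \<inter> {..a + b}" by auto
  then have cl: "closed {r \<in> R. r \<le> a + b}" using closed_Int[OF closed_R closed_atMost] by simp
  have z: "0 \<in> {r \<in> R. r \<le> a + b}" using assms nonneg_R zero_R by (simp add: add_nonneg_nonneg)
  have bdd: "bdd_above {r \<in> R. r \<le> a + b}" by (auto intro: bdd_aboveI)
  have "a \<oplus> b \<in> {r \<in> R. r \<le> a + b}"
    unfolding oplus_def using closed_contains_Sup[OF _ bdd cl] z by blast
  then show "a \<oplus> b \<in> R" "a \<oplus> b \<le> a + b" by auto
qed

lemma oplus_ge: "r \<in> R \<Longrightarrow> r \<le> a + b \<Longrightarrow> r \<le> a \<oplus> b"
  unfolding oplus_def by (rule cSup_upper) (auto intro: bdd_aboveI)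

lemma oplus_commute: "a \<oplus> b = b \<oplus> a"
  by (simp add: oplus_def add.commute)

lemma oplus_mono: "a \<in> R \<Longrightarrow> b \<in> R \<Longrightarrow> a \<le> a' \<Longrightarrow> b \<le> b' \<Longrightarrow> a \<oplus> b \<le> a' \<oplus> b'"
  by (intro oplus_ge oplus_in) (auto dest: oplus_le)

lemma oplus_zero: "a \<in> R \<Longrightarrow> a \<oplus> 0 = a"
  using oplus_ge[of a a 0] oplus_le[of a 0] zero_R by force

lemma oplus_ge1: "a \<in> R \<Longrightarrow> b \<in> R \<Longrightarrow> a \<le> a \<oplus> b"
  by (intro oplus_ge) (auto simp: nonneg_R)

lemma oplus_assoc_le:
  assumes "a \<in> R" "b \<in> R" "c \<in> R"
  shows "(a \<oplus> b) \<oplus> c \<le> a \<oplus> (b \<oplus> c)"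
proof (rule oplus_ge)
  show "a \<oplus> b \<oplus> c \<in> R" using assms by (intro oplus_in)
  show "a \<oplus> b \<oplus> c \<le> a + (b \<oplus> c)"
    using amalg[OF assms] by (simp add: oplus_def)
qed

text \<open>By commutativity the reverse inequality is the same one applied to
  \<open>c, b, a\<close>.\<close>

lemma oplus_assoc:
  assumes "a \<in> R" "b \<in> R" "c \<in> R"
  shows "(a \<oplus> b) \<oplus> c = a \<oplus> (b \<oplus> c)"
  using oplus_assoc_le[OF assms] oplus_assoc_le[OF assms(3,2,1)]
  by (simp add: oplus_commute)

text \<open>Adding the two hypotheses gives only \<open>r + s\<close>, which may exceed
  \<open>r \<oplus> s\<close>. The sharper bound passes through \<open>x \<oplus> r\<close>, an
  element of \<open>R\<close>, and uses associativity.\<close>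

lemma oplus_chain:
  assumes R: "x \<in> R" "y \<in> R" "z \<in> R" "r \<in> R" "s \<in> R" and "y \<le> x + r" "z \<le> y + s"
  shows "z \<le> x + (r \<oplus> s)"
proof -
  have "y \<le> x \<oplus> r" using assms by (intro oplus_ge)
  then have "z \<le> (x \<oplus> r) \<oplus> s" using assms by (intro oplus_ge) auto
  also have "\<dots> = x \<oplus> (r \<oplus> s)" using R by (intro oplus_assoc)
  also have "\<dots> \<le> x + (r \<oplus> s)" using R by (intro oplus_le oplus_in)
  finally show ?thesis .
qed

lemma Sup_R: "Sup R \<in> R"
  using closed_contains_Sup[OF _ bdd_R closed_R] zero_R by blast

lemma le_Sup_R: "r \<in> R \<Longrightarrow> r \<le> Sup R"
  using bdd_R by (rule cSup_upper[rotated])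

lemma Inf_in_R:
  assumes "A \<subseteq> R" "A \<noteq> {}"
  shows "Inf A \<in> R"
proof -
  have "bdd_below A" using assms nonneg_R by (intro bdd_belowI[of _ 0]) auto
  then have "Inf A \<in> closure A" using closure_contains_Inf assms(2) by blast
  also have "\<dots> \<subseteq> R" using closure_minimal[OF assms(1) closed_R] .
  finally show ?thesis .
qed

section \<open>Walk pseudometrics with values in \<open>R\<close>\<close>

inductive walk :: "('n \<Rightarrow> 'n \<Rightarrow> real \<Rightarrow> bool) \<Rightarrow> 'n \<Rightarrow> 'n \<Rightarrow> real \<Rightarrow> bool" for E where
  walk_Nil: "walk E a a 0"
| walk_Cons: "E a b r \<Longrightarrow> walk E b c s \<Longrightarrow> walk E a c (r \<oplus> s)"

text \<open>\<open>Sup R\<close> is the value for points not joined by a walk. Since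
  \<open>R\<close> is closed, the infimum is again a distance.\<close>

definition wdist :: "('n \<Rightarrow> 'n \<Rightarrow> real \<Rightarrow> bool) \<Rightarrow> 'n \<Rightarrow> 'n \<Rightarrow> real" where
  "wdist E a b = Inf (insert (Sup R) {s. walk E a b s})"

end

locale distance_graph = distance_set +
  fixes E :: "'n \<Rightarrow> 'n \<Rightarrow> real \<Rightarrow> bool"
  assumes E_in: "\<And>a b r. E a b r \<Longrightarrow> r \<in> R" and E_sym: "\<And>a b r. E a b r \<Longrightarrow> E b a r"
begin

lemma walk_in: "walk E a b s \<Longrightarrow> s \<in> R"
  by (induction rule: walk.induct) (auto simp: zero_R oplus_in E_in)

lemma walk_trans: "walk E a b s \<Longrightarrow> walk E b c t \<Longrightarrow> walk E a c (s \<oplus> t)"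
proof (induction rule: walk.induct)
  case (walk_Nil a)
  then show ?case using walk_in by (simp add: oplus_commute[of 0] oplus_zero)
next
  case (walk_Cons a b r c' s)
  have "walk E a c (r \<oplus> (s \<oplus> t))" by (rule walk.walk_Cons[OF walk_Cons.hyps(1) walk_Cons.IH[OF walk_Cons.prems]])
  moreover have "r \<oplus> (s \<oplus> t) = (r \<oplus> s) \<oplus> t"
    by (rule oplus_assoc[symmetric]) (use walk_Cons walk_in E_in in blast)+
  ultimately show ?case by simp
qed

lemma walk_edge: "E a b r \<Longrightarrow> walk E a b r"
  using walk.walk_Cons[of E a b r b 0] walk_Nil[of E b] E_in by (simp add: oplus_zero)

lemma walk_sym: "walk E a b s \<Longrightarrow> walk E b a s"
proof (induction rule: walk.induct)
  case (walk_Cons a b r c s)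
  have "walk E c a (s \<oplus> r)" by (rule walk_trans[OF walk_Cons.IH walk_edge[OF E_sym[OF walk_Cons.hyps(1)]]])
  then show ?case by (simp add: oplus_commute)
qed (rule walk_Nil)

lemma wdist_set: "insert (Sup R) {s. walk E a b s} \<subseteq> R"
  using Sup_R walk_in by auto

lemma bdd_wdist_set: "bdd_below (insert (Sup R) {s. walk E a b s})"
  using wdist_set nonneg_R by (intro bdd_belowI[of _ 0]) blast

lemma wdist_in: "wdist E a b \<in> R"
  unfolding wdist_def by (intro Inf_in_R wdist_set) simp

lemma wdist_le: "walk E a b s \<Longrightarrow> wdist E a b \<le> s"
  unfolding wdist_def by (intro cInf_lower bdd_wdist_set) simp

lemma wdist_le_edge: "E a b r \<Longrightarrow> wdist E a b \<le> r"
  by (intro wdist_le walk_edge)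

lemma wdist_ge: "r \<in> R \<Longrightarrow> (\<And>s. walk E a b s \<Longrightarrow> r \<le> s) \<Longrightarrow> r \<le> wdist E a b"
  unfolding wdist_def by (intro cInf_greatest) (auto simp: le_Sup_R)

lemma wdist_self: "wdist E a a = 0"
  using wdist_le[OF walk_Nil[of E a]] nonneg_R[OF wdist_in] by (simp add: antisym)

lemma wdist_sym: "wdist E a b = wdist E b a"
proof -
  have "{s. walk E a b s} = {s. walk E b a s}" using walk_sym by blast
  then show ?thesis by (simp add: wdist_def)
qed

lemma wdist_triangle: "wdist E a c \<le> wdist E a b + wdist E b c"
proof -
  let ?A = "insert (Sup R) {s. walk E a b s}" and ?B = "insert (Sup R) {s. walk E b c s}"
  have 1: "wdist E a c \<le> s + t" if "s \<in> ?A" "t \<in> ?B" for s t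
  proof (cases "walk E a b s \<and> walk E b c t")
    case True
    then have "wdist E a c \<le> s \<oplus> t" by (intro wdist_le walk_trans) auto
    then show ?thesis using oplus_le[of s t] True walk_in by fastforce
  next
    \<comment> \<open>One summand is then the default \<open>Sup R\<close>, which already bounds
      every distance.\<close>
    case False
    have "0 \<le> s" "0 \<le> t" using that wdist_set nonneg_R by blast+
    then have "Sup R \<le> s + t" using False that by auto
    then show ?thesis using le_Sup_R[OF wdist_in] by (meson order_trans)
  qed
  have "wdist E a c - t \<le> wdist E a b" if "t \<in> ?B" for t
    unfolding wdist_def[of E a b] by (rule cInf_greatest) (use 1[OF _ that] in \<open>auto simp: algebra_simps\<close>)
  then have "wdist E a c - wdist E a b \<le> wdist E b c"
    unfolding wdist_def[of E b c] by (intro cInf_greatest) (auto simp: algebra_simps)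
  then show ?thesis by simp
qed

text \<open>The tool for lower bounds on walks. Values in \<open>R\<close> are required so that
  \<open>oplus_chain\<close> can compose the steps.\<close>

lemma walk_Lipschitz:
  assumes F: "\<And>a. F a \<in> R" "\<And>a b r. E a b r \<Longrightarrow> F b \<le> F a + r"
  shows "walk E a b s \<Longrightarrow> F b \<le> F a + s"
proof (induction rule: walk.induct)
  case (walk_Cons a b r c s)
  then show ?case using oplus_chain[of "F a" "F b" "F c" r s] F E_in walk_in by blast
qed simp

end

text \<open>Words are joined by the rule of a one-point metric extension: the letters of a word are the
  distances to the earlier points, and the empty position after its end has distance \<open>0\<close>.\<close>

definition letter :: "nat \<Rightarrow> real list \<Rightarrow> real" where
  "letter i w = (if i < length w then w ! i else 0)"

definition word_edge :: "real set \<Rightarrow> real list \<Rightarrow> real list \<Rightarrow> real \<Rightarrow> bool" where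
  "word_edge S u v r \<longleftrightarrow> set u \<subseteq> S \<and> set v \<subseteq> S \<and> length u \<noteq> length v \<and>
     (\<forall>i\<le>min (length u) (length v). \<bar>letter i u - letter i v\<bar> \<le> r \<and> r \<le> letter i u + letter i v)"

lemma word_edge_sym: "word_edge S u v r \<Longrightarrow> word_edge S v u r"
  by (auto simp: word_edge_def min.commute abs_minus_commute add.commute)

text \<open>At the position just after the shorter word its letter is 0, so both inequalities there
  force \<open>r\<close> to be the letter of the longer word.\<close>

lemma word_edge_in:
  assumes "word_edge S u v r" "\<And>s. s \<in> S \<Longrightarrow> 0 < s"
  shows "r \<in> S"
proof -
  have *: "r \<in> S" if "word_edge S u v r" "length u < length v" for u v
  proof -
    have "v ! length u \<in> S" using that by (auto simp: word_edge_def)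
    moreover have "\<bar>v ! length u\<bar> \<le> r" "r \<le> v ! length u"
      using that(1)[unfolded word_edge_def] that(2) by (auto simp: letter_def dest!: spec[of _ "length u"])
    ultimately have "r = v ! length u" using assms(2) by force
    then show ?thesis using \<open>v ! length u \<in> S\<close> by simp
  qed
  show ?thesis using *[of u v] *[of v u] assms(1) word_edge_sym[OF assms(1)]
    by (cases "length u < length v") (auto simp: word_edge_def)
qed

locale word_graph = distance_set +
  fixes S :: "real set"
  assumes S_R: "S \<subseteq> R" and S_pos: "\<And>s. s \<in> S \<Longrightarrow> 0 < s"
begin

sublocale distance_graph R "word_edge S"
  using word_edge_in S_pos S_R word_edge_sym by unfold_locales blast+

lemma letter_in: "set u \<subseteq> S \<Longrightarrow> letter i u \<in> R"
  using S_R zero_R by (auto simp: letter_def subset_iff)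

text \<open>The witness \<open>n\<close> is the least length of a word visited: up to position \<open>n\<close> all letters along
  the walk are comparable, and the walk touches the value \<open>0\<close> there.\<close>

lemma walk_word:
  assumes "walk (word_edge S) u v s" "set u \<subseteq> S"
  shows "set v \<subseteq> S \<and> (\<exists>n\<le>min (length u) (length v). (\<forall>j\<le>n. letter j v \<le> letter j u + s) \<and>
    (\<exists>s1\<in>R. \<exists>s2\<in>R. s = s1 \<oplus> s2 \<and> letter n u \<le> s1 \<and> letter n v \<le> s2))"
  using assms
proof (induction rule: walk.induct)
  case (walk_Nil a)
  have "0 = 0 \<oplus> (0::real)" using zero_R by (simp add: oplus_zero)
  moreover have "length a \<le> min (length a) (length a)" "letter (length a) a \<le> 0" "\<forall>j\<le>length a. letter j a \<le> letter j a + 0"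
    by (simp_all add: letter_def)
  ultimately show ?case using walk_Nil zero_R by blast
next
  case (walk_Cons a b r c s)
  have ab: "set a \<subseteq> S" "set b \<subseteq> S" using walk_Cons.hyps(1) by (auto simp: word_edge_def)
  obtain n s1 s2 where n: "n \<le> length b" "n \<le> length c" "\<And>j. j \<le> n \<Longrightarrow> letter j c \<le> letter j b + s"
    and s: "s1 \<in> R" "s2 \<in> R" "s = s1 \<oplus> s2" "letter n b \<le> s1" "letter n c \<le> s2" and c: "set c \<subseteq> S"
    using walk_Cons.IH[OF ab(2)] by auto
  have rs: "r \<in> R" "s \<in> R" using E_in walk_in walk_Cons.hyps by blast+
  have e: "letter j b \<le> letter j a + r" "letter j a \<le> letter j b + r" if "j \<le> length a" "j \<le> length b" for j
  proof -
    have "\<bar>letter j a - letter j b\<bar> \<le> r" using walk_Cons.hyps(1) that by (auto simp: word_edge_def)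
    then show "letter j b \<le> letter j a + r" "letter j a \<le> letter j b + r" by linarith+
  qed
  have lip: "letter j c \<le> letter j a + (r \<oplus> s)" if "j \<le> n" "j \<le> length a" for j
    using that n e[of j] rs ab c by (intro oplus_chain[of _ "letter j b"] letter_in) auto
  show ?case
  proof (cases "n \<le> length a")
    case True
    have "r \<oplus> s = (r \<oplus> s1) \<oplus> s2" using rs s by (simp add: oplus_assoc)
    moreover have "letter n a \<le> r \<oplus> s1"
      using e(2)[OF True n(1)] s(4) letter_in[OF ab(1)] by (intro oplus_ge) auto
    moreover have "r \<oplus> s1 \<in> R" using rs s oplus_in by blast
    moreover have "n \<le> min (length a) (length c)" "\<forall>j\<le>n. letter j c \<le> letter j a + (r \<oplus> s)"
      using True n(2) lip by simp_all
    ultimately show ?thesis using s(2,5) c by blast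
  next
    case False
    \<comment> \<open>Now \<open>a\<close> is the shortest word visited. It has letter 0 just after
      its end, so the witness moves there and the length splits as
      \<open>0 \<oplus> (r \<oplus> s)\<close>.\<close>
    have "letter (length a) c \<le> r \<oplus> s"
      using lip[of "length a"] False by (simp add: letter_def)
    moreover have "r \<oplus> s = 0 \<oplus> (r \<oplus> s)" "r \<oplus> s \<in> R" using rs oplus_in by (auto simp: oplus_commute[of 0] oplus_zero)
    moreover have "length a \<le> min (length a) (length c)" "letter (length a) a \<le> 0"
      "\<forall>j\<le>length a. letter j c \<le> letter j a + (r \<oplus> s)"
      using False n(2) lip by (simp_all add: letter_def)
    ultimately show ?thesis using zero_R c by blast
  qed
qed

text \<open>No detour is shorter: at the witness position of \<open>walk_word\<close>,
  \<open>r\<close> is at most the sum of the two letters, hence at most \<open>s1 + s2\<close>, and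
  as an element of \<open>R\<close> at most \<open>s1 \<oplus> s2\<close>.\<close>

lemma word_edge_geodesic:
  assumes e: "word_edge S u v r"
  shows "wdist (word_edge S) u v = r"
proof (rule antisym[OF wdist_le_edge[OF e]])
  show "r \<le> wdist (word_edge S) u v"
  proof (rule wdist_ge)
    show "r \<in> R" using E_in[OF e] .
    fix s assume "walk (word_edge S) u v s"
    then obtain n s1 s2 where n: "n \<le> min (length u) (length v)"
      and s: "s1 \<in> R" "s2 \<in> R" "s = s1 \<oplus> s2" "letter n u \<le> s1" "letter n v \<le> s2"
      using walk_word[of u v s] e by (auto simp: word_edge_def)
    have "r \<le> letter n u + letter n v" using e n by (auto simp: word_edge_def)
    then show "r \<le> s" using s \<open>r \<in> R\<close> by (auto intro: oplus_ge)
  qed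
qed

end

section \<open>Substitutions preserve the word metric\<close>

lemma word_edgeI:
  assumes uv: "set u \<subseteq> S" "set v \<subseteq> S" and v: "v = z @ y"
    and z: "list_all2 (\<lambda>a b. \<bar>a - b\<bar> \<le> r \<and> r \<le> a + b) (u @ [0]) z"
  shows "word_edge S u v r"
proof -
  \<comment> \<open>The 0 appended to \<open>u\<close> stands for its empty position; hence the
    extra index.\<close>
  have len: "length z = Suc (length u)" using list_all2_lengthD[OF z] by simp
  have "\<bar>letter i u - letter i v\<bar> \<le> r \<and> r \<le> letter i u + letter i v" if "i \<le> length u" for i
  proof -
    have "letter i u = (u @ [0]) ! i" using that by (auto simp: letter_def nth_append)
    moreover have "letter i v = z ! i" using that len by (simp add: letter_def v nth_append)
    ultimately show ?thesis using list_all2_nthD[OF z, of i] that by simp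
  qed
  then show ?thesis using uv len v by (simp add: word_edge_def)
qed

lemma word_prefix_append:
  "\<exists>y. word_prefix b (w @ w') = word_prefix b w @ y"
proof (induction w' rule: rev_induct)
  case (snoc a w')
  then show ?case by (metis append_assoc word_prefix_snoc)
qed simp

lemma list_all2_word_prefix:
  assumes "list_all2 (\<lambda>a b. \<bar>a - b\<bar> \<le> r \<and> r \<le> a + b) w w'"
  shows "list_all2 (\<lambda>a b. \<bar>a - b\<bar> \<le> r \<and> r \<le> a + b) (word_prefix b w) (word_prefix b w')"
  using assms
proof (induction w arbitrary: w' rule: rev_induct)
  case Nil
  then show ?case by (simp add: word_prefix_def)
next
  case (snoc a w)
  then obtain u a' where w': "w' = u @ [a']"
    by (cases w' rule: rev_cases) auto
  have len: "length w = length u" using list_all2_lengthD[OF snoc.prems] w' by simp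
  then have u: "list_all2 (\<lambda>a b. \<bar>a - b\<bar> \<le> r \<and> r \<le> a + b) w u" and a: "\<bar>a - a'\<bar> \<le> r" "r \<le> a + a'"
    using snoc.prems w' by (auto simp: list_all2_append)
  \<comment> \<open>\<open>max\<close> with a fixed \<open>y\<close> does not increase differences,
    and raising letters can only increase their sum.\<close>
  have "list_all2 (\<lambda>a b. \<bar>a - b\<bar> \<le> r \<and> r \<le> a + b) (map (max a) y) (map (max a') y)" for y
    using a by (induction y) (auto simp: max_def)
  then show ?case using snoc.IH[OF u] len
    unfolding w' word_prefix_snoc by (simp add: list_all2_appendI)
qed

lemma set_word_subst:
  assumes S: "\<And>s. s \<in> S \<Longrightarrow> 0 < s" and b: "\<And>n. set (b n) \<subseteq> insert 0 S" and w: "set w \<subseteq> S"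
  shows "set (word_subst b w) \<subseteq> S"
proof
  fix x assume "x \<in> set (word_subst b w)"
  then consider i y where "i < length w" "y \<in> set (b i)" "x = max (w ! i) y"
    | "x \<in> set (b (length w))" "x \<noteq> 0"
    by (auto simp: word_subst_def word_prefix_def dest: set_takeWhileD)
  then show "x \<in> S"
  proof cases
    case 1
    then have "w ! i \<in> S" "y \<in> insert 0 S" using w b by (auto simp: subset_iff)
    then show ?thesis using 1 S[of "w ! i"] by (auto simp: max_def)
  qed (use b in blast)
qed

text \<open>Earlier blocks are raised to compatible levels. In the next block the longer word is
  raised to level \<open>r\<close> itself: a letter \<open>t\<close> of the cut-off part meets
  \<open>max r t\<close>, and the empty position of the shorter word meets the raised variable
  \<open>max r 0 = r\<close>.\<close>

lemma word_subst_edge: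
  assumes S: "\<And>s. s \<in> S \<Longrightarrow> 0 < s" and b: "\<And>n. set (b n) \<subseteq> insert 0 S" "\<And>n. 0 \<in> set (b n)"
    and w: "set w \<subseteq> S" "set w' \<subseteq> S" and len: "length w < length w'" and r: "w' ! length w = r"
    and ww: "\<And>i. i < length w \<Longrightarrow> \<bar>w ! i - w' ! i\<bar> \<le> r \<and> r \<le> w ! i + w' ! i"
  shows "word_edge S (word_subst b w) (word_subst b w') r"
proof -
  let ?Q = "\<lambda>a b. \<bar>a - b\<bar> \<le> r \<and> r \<le> a + b"
  define k where "k = length w"
  define u where "u = take k w'"
  define tw where "tw = takeWhile (\<lambda>x. x \<noteq> 0) (b k)"
  have "0 < r" using r len w(2) S by (metis nth_mem subsetD)
  have "dropWhile (\<lambda>x. x \<noteq> 0) (b k) \<noteq> []" using b(2)[of k] by (auto simp: dropWhile_eq_Nil_conv)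
  then obtain z0 z where dz: "dropWhile (\<lambda>x. x \<noteq> 0) (b k) = z0 # z" by (cases "dropWhile (\<lambda>x. x \<noteq> 0) (b k)") auto
  then have "z0 = 0" using hd_dropWhile[of "\<lambda>x. x \<noteq> 0" "b k"] by simp
  then have bk: "b k = tw @ 0 # z"
    using takeWhile_dropWhile_id[of "\<lambda>x. x \<noteq> 0" "b k"] dz by (simp add: tw_def)
  have "w' = (u @ [r]) @ drop (Suc k) w'"
    using id_take_nth_drop[OF len] r by (simp add: u_def k_def)
  then obtain y where "word_prefix b w' = word_prefix b (u @ [r]) @ y"
    using word_prefix_append by metis
  moreover have "length u = k" using len by (simp add: u_def k_def)
  ultimately have "word_prefix b w' = word_prefix b u @ map (max r) (tw @ [0]) @ map (max r) z @ y"
    by (simp add: word_prefix_snoc bk)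
  then obtain y' where y': "word_subst b w' = (word_prefix b u @ map (max r) (tw @ [0])) @ y'"
    by (simp add: word_subst_def)
  have "list_all2 ?Q w u"
    using ww len by (intro list_all2_all_nthI) (auto simp: u_def k_def)
  then have 1: "list_all2 ?Q (word_prefix b w) (word_prefix b u)" by (rule list_all2_word_prefix)
  have "\<forall>x\<in>set (tw @ [0]). 0 \<le> x"
    using b(1)[of k] S bk by (force intro: less_imp_le)
  then have "list_all2 ?Q xs (map (max r) xs)" if "set xs \<subseteq> set (tw @ [0])" for xs
    using that \<open>0 < r\<close> by (induction xs) (auto simp: max_def)
  from this[OF order.refl] have 2: "list_all2 ?Q (tw @ [0]) (map (max r) (tw @ [0]))" .
  have 3: "word_subst b w @ [0] = word_prefix b w @ (tw @ [0])" by (simp add: word_subst_def tw_def k_def)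
  show ?thesis
  proof (rule word_edgeI)
    show "set (word_subst b w) \<subseteq> S" "set (word_subst b w') \<subseteq> S"
      by (rule set_word_subst; simp add: S b(1) w)+
    show "list_all2 ?Q (word_subst b w @ [0]) (word_prefix b u @ map (max r) (tw @ [0]))"
      unfolding 3 by (rule list_all2_appendI[OF 1 2])
  qed (rule y')
qed


section \<open>Rounding distances to a finite set\<close>

context distance_set
begin

text \<open>\<open>R\<close> is cut into intervals of length \<open>\<eta>\<close>; the largest
  distance in each nonempty interval, attained since \<open>R\<close> is closed, serves all others
  in it.\<close>

lemma finite_cover:
  assumes "0 < \<eta>" "\<eta> \<in> R"
  obtains G where "finite G" "G \<subseteq> R" "\<And>g. g \<in> G \<Longrightarrow> 0 < g"
    "\<And>r. r \<in> R \<Longrightarrow> 0 < r \<Longrightarrow> \<exists>g\<in>G. r \<le> g \<and> g \<le> r + \<eta>"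
proof -
  define J where "J n = R \<inter> {real n * \<eta> .. real (Suc n) * \<eta>}" for n
  define N where "N = nat \<lceil>Sup R / \<eta>\<rceil>"
  define G where "G = (\<lambda>n. Sup (J n)) ` {n. n \<le> N \<and> J n \<noteq> {}}"
  have bJ: "bdd_above (J n)" for n by (auto simp: J_def)
  have SJ: "Sup (J n) \<in> J n" if "J n \<noteq> {}" for n
    by (rule closed_contains_Sup[OF that bJ]) (simp add: J_def closed_Int closed_R)
  show ?thesis
  proof
    show "finite G" by (simp add: G_def)
    show "G \<subseteq> R" using SJ by (auto simp: G_def J_def)
    show "0 < g" if "g \<in> G" for g
    proof -
      obtain n where n: "J n \<noteq> {}" "g = Sup (J n)" using \<open>g \<in> G\<close> by (auto simp: G_def)
      show ?thesis
      proof (cases n)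
        case 0
        \<comment> \<open>The first interval also contains 0; \<open>\<eta>\<close> being a distance
          keeps its maximum positive.\<close>
        have "\<eta> \<in> J 0" using assms by (simp add: J_def)
        then have "\<eta> \<le> g" unfolding n 0 using bJ by (rule cSup_upper)
        then show ?thesis using assms by simp
      next
        case (Suc m)
        have "0 < real n * \<eta>" using assms Suc by simp
        then show ?thesis using SJ[OF n(1)] n(2) by (auto simp: J_def)
      qed
    qed
    show "\<exists>g\<in>G. r \<le> g \<and> g \<le> r + \<eta>" if r: "r \<in> R" "0 < r" for r
    proof -
      define n where "n = nat \<lfloor>r / \<eta>\<rfloor>"
      have rn: "real n = of_int \<lfloor>r / \<eta>\<rfloor>" using r assms by (simp add: n_def)
      have n1: "real n * \<eta> \<le> r" "r \<le> real (Suc n) * \<eta>"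
        using assms floor_divide_lower[of \<eta> r] floor_divide_upper[of \<eta> r]
        by (simp_all add: rn algebra_simps)
      then have rJ: "r \<in> J n" using r by (simp add: J_def)
      have "r / \<eta> \<le> Sup R / \<eta>" using assms r le_Sup_R by (simp add: divide_right_mono)
      then have "real n \<le> Sup R / \<eta>" unfolding rn by linarith
      then have "n \<le> N" unfolding N_def by linarith
      then have "Sup (J n) \<in> G" using rJ by (auto simp: G_def)
      moreover have "r \<le> Sup (J n)" using rJ bJ by (rule cSup_upper)
      moreover have "Sup (J n) \<le> real (Suc n) * \<eta>"
        using SJ[of n] rJ by (metis J_def IntD2 atLeastAtMost_iff empty_iff)
      moreover have "real (Suc n) * \<eta> \<le> r + \<eta>" using n1(1) by (simp add: algebra_simps)
      ultimately show ?thesis by (meson order_trans)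
    qed
  qed
qed

section \<open>The finite semigroup generated by a cover\<close>

inductive_set oplus_span :: "real set \<Rightarrow> real set" for G where
  span_base: "g \<in> G \<Longrightarrow> g \<in> oplus_span G"
| span_step: "s \<in> oplus_span G \<Longrightarrow> g \<in> G \<Longrightarrow> s \<oplus> g \<in> oplus_span G"

context
  fixes G assumes fin_G: "finite G" and G_R: "G \<subseteq> R" and G_pos: "\<And>g. g \<in> G \<Longrightarrow> 0 < g"
begin

lemma span_R: "s \<in> oplus_span G \<Longrightarrow> s \<in> R"
  by (induction rule: oplus_span.induct) (use G_R in \<open>auto intro: oplus_in\<close>)

lemma span_pos: "s \<in> oplus_span G \<Longrightarrow> 0 < s"
proof (induction rule: oplus_span.induct)
  case (span_step s g)
  then show ?case using oplus_ge1[of s g] span_R[of s] G_R by fastforce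
qed (rule G_pos)

text \<open>Associativity turns sums built by adding single generators on the right into a
  semigroup.\<close>

lemma span_oplus: "t \<in> oplus_span G \<Longrightarrow> s \<in> oplus_span G \<Longrightarrow> s \<oplus> t \<in> oplus_span G"
proof (induction rule: oplus_span.induct)
  case (span_step t g)
  have "s \<oplus> t \<oplus> g = s \<oplus> (t \<oplus> g)"
    using span_step span_R G_R by (intro oplus_assoc) auto
  then show ?case using oplus_span.span_step[OF span_step.IH[OF span_step.prems] span_step.hyps(2)] by simp
qed (rule oplus_span.span_step)

lemma span_cases:
  "s \<in> oplus_span G \<Longrightarrow> s \<in> G \<or> (\<exists>s'\<in>oplus_span G. \<exists>g\<in>G. s = s' \<oplus> g \<and> s' < s)"
proof (induction rule: oplus_span.induct)
  case (span_step s g)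
  have "s \<le> s \<oplus> g" using span_step span_R G_R by (intro oplus_ge1) auto
  then show ?case using span_step by (cases "s = s \<oplus> g") (simp, force)
qed simp

text \<open>Two consecutive strict increases \<open>s'' < s'' \<oplus> g' < s'' \<oplus> g' \<oplus> g\<close> advance by more than the
  least generator, since the middle term is the largest distance not exceeding \<open>s'' + g'\<close>.\<close>

lemma finite_span: "finite (oplus_span G)"
proof (cases "G = {}")
  case True
  then show ?thesis using span_cases by (metis (no_types, opaque_lifting) empty_iff finite.emptyI subsetI finite_subset)
next
  case False
  define \<gamma> where "\<gamma> = Min G"
  have \<gamma>: "0 < \<gamma>" "\<And>g. g \<in> G \<Longrightarrow> \<gamma> \<le> g" using fin_G False G_pos by (auto simp: \<gamma>_def)
  \<comment> \<open>The span is exhausted in layers of width \<open>\<gamma>\<close>; finitely many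
    reach \<open>Sup R\<close>.\<close>
  have "finite {s \<in> oplus_span G. s \<le> real m * \<gamma>}" for m
  proof (induction m)
    case 0
    have "{s \<in> oplus_span G. s \<le> real 0 * \<gamma>} = {}" using span_pos by force
    then show ?case by (simp only: finite.emptyI)
  next
    case (Suc m)
    let ?A = "{s \<in> oplus_span G. s \<le> real m * \<gamma>}"
    have "{s \<in> oplus_span G. s \<le> real (Suc m) * \<gamma>} \<subseteq> G \<union> (\<lambda>(a, b). a \<oplus> b) ` (G \<times> G)
      \<union> (\<lambda>(a, b, c). a \<oplus> b \<oplus> c) ` (?A \<times> G \<times> G)"
    proof
      fix s assume s: "s \<in> {s \<in> oplus_span G. s \<le> real (Suc m) * \<gamma>}"
      show "s \<in> G \<union> (\<lambda>(a, b). a \<oplus> b) ` (G \<times> G) \<union> (\<lambda>(a, b, c). a \<oplus> b \<oplus> c) ` (?A \<times> G \<times> G)"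
      proof (cases "s \<in> G")
        case False
        then obtain s' g where s': "s' \<in> oplus_span G" "g \<in> G" "s = s' \<oplus> g" "s' < s"
          using s span_cases by blast
        show ?thesis
        proof (cases "s' \<in> G")
          case True
          then show ?thesis using s' by force
        next
          case False
          then obtain s'' g' where s'': "s'' \<in> oplus_span G" "g' \<in> G" "s' = s'' \<oplus> g'"
            using s' span_cases by blast
          have "\<not> s \<le> s'' + g'" using oplus_ge[of s s'' g'] s span_R s'(4) s''(3) by fastforce
          then have "s'' \<le> real m * \<gamma>" using s \<gamma>(2)[OF s''(2)] by (simp add: algebra_simps)
          then have "(s'', g', g) \<in> ?A \<times> G \<times> G" using s'' s' by simp
          then have "(\<lambda>(a, b, c). a \<oplus> b \<oplus> c) (s'', g', g) \<in> (\<lambda>(a, b, c). a \<oplus> b \<oplus> c) ` (?A \<times> G \<times> G)"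
            by (rule imageI)
          then show ?thesis using s' s'' by simp
        qed
      qed simp
    qed
    then show ?case
      by (rule finite_subset) (intro finite_UnI finite_imageI finite_cartesian_product fin_G Suc)
  qed
  moreover have "oplus_span G \<subseteq> {s \<in> oplus_span G. s \<le> real (nat \<lceil>Sup R / \<gamma>\<rceil>) * \<gamma>}"
  proof
    fix s assume s: "s \<in> oplus_span G"
    have "Sup R / \<gamma> \<le> real (nat \<lceil>Sup R / \<gamma>\<rceil>)" by linarith
    then have "Sup R \<le> real (nat \<lceil>Sup R / \<gamma>\<rceil>) * \<gamma>" using \<gamma>(1) by (simp add: field_simps)
    then show "s \<in> {s \<in> oplus_span G. s \<le> real (nat \<lceil>Sup R / \<gamma>\<rceil>) * \<gamma>}"
      using s le_Sup_R[OF span_R[OF s]] by simp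
  qed
  ultimately show ?thesis by (meson finite_subset)
qed

end

lemma finite_closed_net:
  assumes "0 < \<eta>" "\<eta> \<in> R"
  obtains S where "finite S" "S \<subseteq> R" "\<And>s. s \<in> S \<Longrightarrow> 0 < s"
    "\<And>s t. s \<in> S \<Longrightarrow> t \<in> S \<Longrightarrow> s \<oplus> t \<in> S"
    "\<And>r. r \<in> R \<Longrightarrow> 0 < r \<Longrightarrow> \<exists>s\<in>S. r \<le> s \<and> s \<le> r + \<eta>"
proof -
  obtain G where G: "finite G" "G \<subseteq> R" "\<And>g. g \<in> G \<Longrightarrow> 0 < g"
    "\<And>r. r \<in> R \<Longrightarrow> 0 < r \<Longrightarrow> \<exists>g\<in>G. r \<le> g \<and> g \<le> r + \<eta>"
    using finite_cover[OF assms] by metis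
  show ?thesis
  proof
    show "finite (oplus_span G)" using finite_span[OF G(1-3)] .
    show "oplus_span G \<subseteq> R" using span_R[OF G(1-3)] by blast
    show "0 < s" if "s \<in> oplus_span G" for s using span_pos[OF G(1-3) that] .
    show "s \<oplus> t \<in> oplus_span G" if "s \<in> oplus_span G" "t \<in> oplus_span G" for s t
      using span_oplus[OF G(1-3) that(2,1)] .
    show "\<exists>s\<in>oplus_span G. r \<le> s \<and> s \<le> r + \<eta>" if "r \<in> R" "0 < r" for r
      using G(4)[OF that] span_base by blast
  qed
qed

text \<open>\<open>\<rho> r\<close> is the least element of \<open>S\<close> above \<open>r\<close>.
  From \<open>a \<le> \<rho> b + \<rho> c\<close> follows
  \<open>a \<le> \<rho> b \<oplus> \<rho> c\<close>, and this bound lies in \<open>S\<close>, so it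
  also bounds \<open>\<rho> a\<close>.\<close>

lemma distance_rounding:
  assumes "0 < \<eta>" "\<eta> \<in> R"
  shows "\<exists>S \<rho>. finite S \<and> S \<subseteq> R \<and> (\<forall>s\<in>S. 0 < s) \<and>
    (\<forall>r\<in>R. 0 < r \<longrightarrow> \<rho> r \<in> S \<and> r \<le> \<rho> r \<and> \<rho> r \<le> r + \<eta>) \<and>
    (\<forall>a\<in>R. \<forall>b\<in>R. \<forall>c\<in>R. 0 < a \<and> 0 < b \<and> 0 < c \<and> a \<le> b + c \<longrightarrow> \<rho> a \<le> \<rho> b + \<rho> c)"
proof -
  obtain S where S: "finite S" "S \<subseteq> R" "\<And>s. s \<in> S \<Longrightarrow> 0 < s"
    "\<And>s t. s \<in> S \<Longrightarrow> t \<in> S \<Longrightarrow> s \<oplus> t \<in> S"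
    and net: "\<And>r. r \<in> R \<Longrightarrow> 0 < r \<Longrightarrow> \<exists>s\<in>S. r \<le> s \<and> s \<le> r + \<eta>"
    using finite_closed_net[OF assms] by metis
  define \<rho> where "\<rho> r = Min {s \<in> S. r \<le> s}" for r
  have fin: "finite {s \<in> S. r \<le> s}" for r using S(1) by simp
  have \<rho>: "\<rho> r \<in> {s \<in> S. r \<le> s}" if "r \<in> R" "0 < r" for r
    unfolding \<rho>_def using net[OF that] by (intro Min_in fin) auto
  have \<rho>_le: "\<rho> r \<le> s" if "s \<in> S" "r \<le> s" for r s
    unfolding \<rho>_def using that by (intro Min_le fin) simp
  show ?thesis
  proof (intro exI conjI ballI impI; (elim conjE)?)
    show "\<rho> r \<in> S" if "r \<in> R" "0 < r" for r using \<rho>[OF that] by simp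
    show "r \<le> \<rho> r" "\<rho> r \<le> r + \<eta>" if r: "r \<in> R" "0 < r" for r
    proof -
      obtain s where s: "s \<in> S" "r \<le> s" "s \<le> r + \<eta>" using net[OF r] by blast
      then show "\<rho> r \<le> r + \<eta>" using \<rho>_le[OF s(1,2)] by simp
    qed (use \<rho>[OF r] in simp)
    show "\<rho> a \<le> \<rho> b + \<rho> c" if "a \<in> R" "b \<in> R" "c \<in> R" "0 < a" "0 < b" "0 < c" "a \<le> b + c" for a b c
    proof -
      have bc: "\<rho> b \<in> S" "\<rho> c \<in> S" "b \<le> \<rho> b" "c \<le> \<rho> c" using \<rho> that by auto
      then have "a \<le> \<rho> b \<oplus> \<rho> c" using that by (intro oplus_ge) auto
      then have "\<rho> a \<le> \<rho> b \<oplus> \<rho> c" using S(4) bc by (intro \<rho>_le) auto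
      also have "\<dots> \<le> \<rho> b + \<rho> c" using S(2) bc by (intro oplus_le) auto
      finally show ?thesis .
    qed
  qed (use S in auto)
qed

end

section \<open>Coupling exact and rounded distances\<close>

text \<open>The space \<open>dV\<close> approximates the target distances \<open>e\<close> only up to \<open>\<eta>\<close>. A branch is a sequence in
  \<open>dV\<close> with distances in \<open>[e, e + \<eta>]\<close>; the coupling adjoins points with the exact distances \<open>e\<close>
  at distance at most \<open>\<eta>\<close> from the entries of the branch.\<close>

locale coupling = distance_set +
  fixes dV :: "'v \<Rightarrow> 'v \<Rightarrow> real" and e :: "nat \<Rightarrow> nat \<Rightarrow> real" and \<eta> :: real
  assumes dV_R: "dV u v \<in> R" and dV_self: "dV u u = 0" and dV_sym: "dV u v = dV v u"
    and dV_triangle: "dV u w \<le> dV u v + dV v w"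
    and e_R: "e i j \<in> R" and e_self: "e i i = 0" and e_sym: "e i j = e j i"
    and e_triangle: "e i k \<le> e i j + e j k"
    and \<eta>_R: "\<eta> \<in> R"
begin

text \<open>The residual of \<oplus>, a truncated difference inside \<open>R\<close>; it gives the
  lower end of the clamping interval.\<close>

definition lo :: "real \<Rightarrow> real \<Rightarrow> real" where
  "lo a b = Inf {r \<in> R. a \<le> r + b}"

lemma lo:
  assumes "a \<in> R" "b \<in> R"
  shows lo_R: "lo a b \<in> R" and le_lo: "a \<le> lo a b + b" and lo_le: "y \<in> R \<Longrightarrow> a \<le> y + b \<Longrightarrow> lo a b \<le> y"
proof -
  let ?A = "{r \<in> R. a \<le> r + b}"
  have "a \<in> ?A" using assms nonneg_R by simp
  then have ne: "?A \<noteq> {}" by blast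
  then show "lo a b \<in> R" unfolding lo_def by (intro Inf_in_R) auto
  have "a - b \<le> lo a b" unfolding lo_def using ne by (intro cInf_greatest) auto
  then show "a \<le> lo a b + b" by simp
  have "bdd_below ?A" using nonneg_R by (intro bdd_belowI[of _ 0]) auto
  then show "lo a b \<le> y" if "y \<in> R" "a \<le> y + b" using that unfolding lo_def by (intro cInf_lower) auto
qed

lemma dV_oplus: "dV u w \<le> dV u v \<oplus> dV v w"
  by (intro oplus_ge dV_R dV_triangle)

lemma e_oplus: "e i k \<le> e i j \<oplus> e j k"
  by (intro oplus_ge e_R e_triangle)

text \<open>The values \<open>c\<close> are clamped, one after the other, into the interval that makes the sequence
  Lipschitz with respect to \<open>e\<close>; the Lipschitz function on the coupling that results certifies
  lower bounds for walks.\<close>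

declare image_cong [fundef_cong]

fun psi :: "(nat \<Rightarrow> real) \<Rightarrow> nat \<Rightarrow> real" where
  "psi c k = Max (insert (Min (insert (c k) ((\<lambda>i. psi c i \<oplus> e i k) ` {..<k})))
    ((\<lambda>i. lo (psi c i) (e i k)) ` {..<k}))"

declare psi.simps [simp del]

lemma psi_cong: "(\<And>j. j \<le> k \<Longrightarrow> c j = c' j) \<Longrightarrow> psi c k = psi c' k"
proof (induction k rule: less_induct)
  case (less k)
  then have "psi c i = psi c' i" if "i < k" for i using that by simp
  then show ?case using less.prems[of k] by (simp add: psi.simps[of _ k])
qed

lemma psi_upper:
  assumes "c k \<le> y" "\<And>i. i < k \<Longrightarrow> lo (psi c i) (e i k) \<le> y"
  shows "psi c k \<le> y"
proof -
  have "Min (insert (c k) ((\<lambda>i. psi c i \<oplus> e i k) ` {..<k})) \<le> c k" by (rule Min_le) auto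
  then have "Min (insert (c k) ((\<lambda>i. psi c i \<oplus> e i k) ` {..<k})) \<le> y" using assms(1) by (rule order_trans)
  then show ?thesis using assms(2) unfolding psi.simps[of c k] by (subst Max_le_iff) auto
qed

lemma psi_lower:
  assumes "y \<le> c k" "\<And>i. i < k \<Longrightarrow> y \<le> psi c i \<oplus> e i k"
  shows "y \<le> psi c k"
proof -
  have "y \<le> Min (insert (c k) ((\<lambda>i. psi c i \<oplus> e i k) ` {..<k}))" using assms by (subst Min_ge_iff) auto
  also have "\<dots> \<le> psi c k" unfolding psi.simps[of c k] by (rule Max_ge) auto
  finally show ?thesis .
qed

context
  fixes c :: "nat \<Rightarrow> real" assumes c_R: "\<And>k. c k \<in> R"
begin

lemma psi_R: "psi c k \<in> R"
proof (induction k rule: less_induct)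
  case (less k)
  let ?B = "insert (c k) ((\<lambda>i. psi c i \<oplus> e i k) ` {..<k})"
  let ?A = "insert (Min ?B) ((\<lambda>i. lo (psi c i) (e i k)) ` {..<k})"
  have "?B \<subseteq> R" using c_R less by (auto intro: oplus_in e_R)
  moreover have "Min ?B \<in> ?B" by (rule Min_in) auto
  ultimately have "?A \<subseteq> R" using less by (auto intro: lo_R e_R)
  moreover have "Max ?A \<in> ?A" by (rule Max_in) auto
  ultimately show ?case unfolding psi.simps[of c k] by blast
qed

text \<open>Clamping can meet all constraints because every lower bound is below every upper bound.
  This consistency follows from the Lipschitz property of the earlier values and
  associativity.\<close>

lemma psi_between:
  "i < k \<Longrightarrow> lo (psi c i) (e i k) \<le> psi c k \<and> psi c k \<le> psi c i \<oplus> e i k"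
proof (induction k arbitrary: i rule: less_induct)
  case (less k)
  have lip: "psi c i \<le> psi c j \<oplus> e i j" if "i < k" "j < k" for i j
  proof (cases i j rule: linorder_cases)
    case less
    then show ?thesis using less.IH[OF that(2) less] le_lo[OF psi_R e_R, of i i j] psi_R
      by (intro oplus_ge) auto
  next
    case equal
    then show ?thesis using oplus_zero[OF psi_R] by (simp add: e_self)
  next
    case greater
    then show ?thesis using less.IH[OF that(1) greater] by (simp add: e_sym)
  qed
  have le: "lo (psi c i) (e i k) \<le> psi c j \<oplus> e j k" if "i < k" "j < k" for i j
  proof (rule lo_le)
    have "psi c i \<le> psi c j \<oplus> (e j k \<oplus> e k i)"
      by (rule order_trans[OF lip[OF that]], rule oplus_mono[OF psi_R e_R])
        (use e_oplus[of j i k] in \<open>simp_all add: e_sym\<close>)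
    also have "\<dots> = (psi c j \<oplus> e j k) \<oplus> e i k" by (simp add: oplus_assoc psi_R e_R e_sym[of k i])
    also have "\<dots> \<le> (psi c j \<oplus> e j k) + e i k" by (intro oplus_le oplus_in psi_R e_R)
    finally show "psi c i \<le> (psi c j \<oplus> e j k) + e i k" .
  qed (intro oplus_in psi_R e_R)+
  let ?m = "Min (insert (c k) ((\<lambda>i. psi c i \<oplus> e i k) ` {..<k}))"
  have "lo (psi c i) (e i k) \<le> psi c k"
    unfolding psi.simps[of c k] by (rule Max_ge) (use less.prems in auto)
  moreover have "?m \<le> psi c i \<oplus> e i k" by (rule Min_le) (use less.prems in auto)
  then have "psi c k \<le> psi c i \<oplus> e i k"
    unfolding psi.simps[of c k] using le less.prems by (subst Max_le_iff) auto
  ultimately show ?case by simp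
qed

lemma psi_Lipschitz: "i \<le> k \<Longrightarrow> psi c k \<le> psi c i + e i k \<and> psi c i \<le> psi c k + e i k"
proof (cases "i = k")
  case False
  assume "i \<le> k"
  with False have "i < k" by simp
  then show ?thesis using psi_between[of i k] oplus_le[OF psi_R e_R, of i i k]
    le_lo[OF psi_R e_R, of i i k] by linarith
qed (simp add: e_self)

text \<open>A bound spreading from a base index \<open>n\<close> along \<open>e\<close> is respected
  by every clamping interval, so errors do not accumulate with \<open>k\<close>.\<close>

lemma psi_upper_bound:
  assumes "y \<in> R"
  shows "(\<And>j. j \<le> k \<Longrightarrow> c j \<le> y \<oplus> e j n) \<Longrightarrow> psi c k \<le> y \<oplus> e k n"
proof (induction k rule: less_induct)
  case (less k)
  show ?case
  proof (rule psi_upper)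
    show "c k \<le> y \<oplus> e k n" using less.prems by simp
    fix i assume i: "i < k"
    have "psi c i \<le> y \<oplus> e i n" using less i by simp
    also have "\<dots> \<le> y \<oplus> (e k n \<oplus> e i k)"
      using assms e_oplus[of i n k] by (intro oplus_mono e_R) (auto simp: oplus_commute)
    also have "\<dots> = (y \<oplus> e k n) \<oplus> e i k" using assms by (simp add: oplus_assoc e_R)
    also have "\<dots> \<le> (y \<oplus> e k n) + e i k" using assms by (intro oplus_le oplus_in e_R)
    finally show "lo (psi c i) (e i k) \<le> y \<oplus> e k n"
      using assms by (intro lo_le psi_R e_R oplus_in)
  qed
qed

lemma psi_lower_bound:
  assumes "y \<in> R"
  shows "(\<And>j. j \<le> k \<Longrightarrow> y \<le> c j \<oplus> e j n) \<Longrightarrow> y \<le> psi c k \<oplus> e k n"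
proof (induction k rule: less_induct)
  case (less k)
  have "lo y (e k n) \<le> psi c k"
  proof (rule psi_lower)
    have "y \<le> c k + e k n" using less.prems[of k] oplus_le[OF c_R e_R, of k k n] by simp
    then show "lo y (e k n) \<le> c k" using assms by (intro lo_le e_R c_R)
    fix i assume i: "i < k"
    have "y \<le> psi c i \<oplus> e i n" using less i by simp
    also have "\<dots> \<le> psi c i \<oplus> (e i k \<oplus> e k n)"
      using e_oplus[of i n k] by (intro oplus_mono e_R psi_R) auto
    also have "\<dots> = (psi c i \<oplus> e i k) \<oplus> e k n" by (simp add: oplus_assoc e_R psi_R)
    also have "\<dots> \<le> (psi c i \<oplus> e i k) + e k n" by (intro oplus_le oplus_in e_R psi_R)
    finally show "lo y (e k n) \<le> psi c i \<oplus> e i k"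
      using assms by (intro lo_le psi_R e_R oplus_in)
  qed
  then show ?case using le_lo[OF assms e_R, of k n] assms by (intro oplus_ge) auto
qed

text \<open>If \<open>c\<close> misses the Lipschitz condition by at most \<open>\<eta>\<close>, the
  two bounds with base index \<open>k\<close> and \<open>y\<close> equal to
  \<open>c k \<oplus> \<eta>\<close> or \<open>lo (c k) \<eta>\<close> show that clamping moves
  \<open>c k\<close> by at most \<open>\<eta>\<close>.\<close>

lemma psi_close:
  assumes "\<And>j. j < k \<Longrightarrow> c j \<le> c k \<oplus> (e j k \<oplus> \<eta>)" "\<And>j. j < k \<Longrightarrow> c k \<le> c j \<oplus> (e j k \<oplus> \<eta>)"
  shows "psi c k \<le> c k + \<eta>" "c k \<le> psi c k + \<eta>"
proof -
  have "psi c k \<le> c k \<oplus> \<eta>"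
  proof (rule psi_upper)
    show "c k \<le> c k \<oplus> \<eta>" by (intro oplus_ge1 c_R \<eta>_R)
    fix i assume i: "i < k"
    have R: "c k \<oplus> \<eta> \<in> R" by (intro oplus_in c_R \<eta>_R)
    have "psi c i \<le> (c k \<oplus> \<eta>) \<oplus> e i k"
    proof (rule psi_upper_bound[OF R])
      fix j assume "j \<le> i"
      then show "c j \<le> (c k \<oplus> \<eta>) \<oplus> e j k"
        using assms(1)[of j] i by (simp add: oplus_assoc c_R e_R \<eta>_R oplus_commute[of "e j k"])
    qed
    also have "\<dots> \<le> (c k \<oplus> \<eta>) + e i k" by (intro oplus_le R e_R)
    finally show "lo (psi c i) (e i k) \<le> c k \<oplus> \<eta>" by (intro lo_le psi_R e_R R)
  qed
  then show "psi c k \<le> c k + \<eta>" using oplus_le[OF c_R \<eta>_R] by (meson order_trans)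
  have R: "lo (c k) \<eta> \<in> R" by (intro lo_R c_R \<eta>_R)
  have "lo (c k) \<eta> \<le> psi c k"
  proof (rule psi_lower)
    show "lo (c k) \<eta> \<le> c k" using nonneg_R[OF \<eta>_R] by (intro lo_le c_R \<eta>_R) simp
    fix i assume i: "i < k"
    show "lo (c k) \<eta> \<le> psi c i \<oplus> e i k"
    proof (rule psi_lower_bound[OF R])
      fix j assume "j \<le> i"
      then have "c k \<le> (c j \<oplus> e j k) \<oplus> \<eta>"
        using assms(2)[of j] i by (simp add: oplus_assoc c_R e_R \<eta>_R)
      also have "\<dots> \<le> (c j \<oplus> e j k) + \<eta>" by (intro oplus_le oplus_in c_R e_R \<eta>_R)
      finally show "lo (c k) \<eta> \<le> c j \<oplus> e j k" by (intro lo_le c_R \<eta>_R oplus_in e_R)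
    qed
  qed
  then show "c k \<le> psi c k + \<eta>" using le_lo[OF c_R \<eta>_R, of k] by simp
qed

end

section \<open>The coupling graph and its potentials\<close>

definition branch :: "'v list \<Rightarrow> bool" where
  "branch t \<longleftrightarrow> t \<noteq> [] \<and> (\<forall>i<length t. \<forall>j<length t. e i j \<le> dV (t ! i) (t ! j) \<and> dV (t ! i) (t ! j) \<le> e i j + \<eta>)"

lemma branch_take: "branch t \<Longrightarrow> branch (take (Suc i) t)"
  by (simp add: branch_def)

text \<open>\<open>Inr t\<close> is the corrected copy of the last entry of \<open>t\<close>.
  Indexing by the whole initial segment arranges the corrections in a tree: branches share points
  exactly as far as they agree.\<close>

inductive cedge :: "'v + 'v list \<Rightarrow> 'v + 'v list \<Rightarrow> real \<Rightarrow> bool" where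
  "cedge (Inl u) (Inl v) (dV u v)"
| "branch t \<Longrightarrow> i < length t \<Longrightarrow> cedge (Inr (take (Suc i) t)) (Inr t) (e i (length t - 1))"
| "branch t \<Longrightarrow> i < length t \<Longrightarrow> cedge (Inr t) (Inr (take (Suc i) t)) (e i (length t - 1))"
| "branch t \<Longrightarrow> cedge (Inr t) (Inl (last t)) \<eta>"
| "branch t \<Longrightarrow> cedge (Inl (last t)) (Inr t) \<eta>"

sublocale cgraph: distance_graph R cedge
proof
  show "r \<in> R" if "cedge a b r" for a b r
    using that by cases (auto simp: dV_R e_R \<eta>_R)
  show "cedge b a r" if "cedge a b r" for a b r
    using that cedge.intros by cases (metis dV_sym | simp)+
qed

text \<open>Lists that are not branches carry no edges, so the value 0 there only has to lie in
  \<open>R\<close>.\<close>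

definition cpot :: "('v \<Rightarrow> real) \<Rightarrow> 'v + 'v list \<Rightarrow> real" where
  "cpot \<Phi> x = (case x of Inl v \<Rightarrow> \<Phi> v
     | Inr t \<Rightarrow> if branch t then psi (\<lambda>j. \<Phi> (t ! j)) (length t - 1) else 0)"

lemma cpot_take:
  assumes "branch t" "i < length t"
  shows "cpot \<Phi> (Inr (take (Suc i) t)) = psi (\<lambda>j. \<Phi> (t ! j)) i"
proof -
  have "length (take (Suc i) t) - 1 = i" using assms(2) by simp
  moreover have "psi (\<lambda>j. \<Phi> (take (Suc i) t ! j)) i = psi (\<lambda>j. \<Phi> (t ! j)) i"
    by (rule psi_cong) simp
  ultimately show ?thesis using branch_take[OF assms(1)] by (simp add: cpot_def)
qed

lemma cpot_close:
  assumes \<Phi>: "\<And>v. \<Phi> v \<in> R" "\<And>u v. \<Phi> v \<le> \<Phi> u + dV u v" and t: "branch t"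
  shows "cpot \<Phi> (Inr t) \<le> cpot \<Phi> (Inl (last t)) + \<eta>" "cpot \<Phi> (Inl (last t)) \<le> cpot \<Phi> (Inr t) + \<eta>"
proof -
  define k where "k = length t - 1"
  let ?c = "\<lambda>j. \<Phi> (t ! j)"
  have last: "last t = t ! k" using t by (simp add: k_def branch_def last_conv_nth)
  have *: "\<Phi> (t ! i) \<le> \<Phi> (t ! j) \<oplus> (e i j \<oplus> \<eta>)" if "i \<le> k" "j \<le> k" for i j
  proof (rule oplus_ge[OF \<Phi>(1)])
    have "length t > 0" using t by (simp add: branch_def)
    then have "i < length t" "j < length t" using that unfolding k_def by linarith+
    then have "dV (t ! j) (t ! i) \<le> e i j + \<eta>" using t by (simp add: branch_def dV_sym[of "t ! j"])
    then have "dV (t ! j) (t ! i) \<le> e i j \<oplus> \<eta>" by (intro oplus_ge dV_R)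
    then show "\<Phi> (t ! i) \<le> \<Phi> (t ! j) + (e i j \<oplus> \<eta>)" using \<Phi>(2)[of "t ! i" "t ! j"] by linarith
  qed
  have "psi ?c k \<le> ?c k + \<eta>" "?c k \<le> psi ?c k + \<eta>"
    using *[of _ k] *[of k] by (intro psi_close \<Phi>(1); simp add: e_sym[of k])+
  then show "cpot \<Phi> (Inr t) \<le> cpot \<Phi> (Inl (last t)) + \<eta>" "cpot \<Phi> (Inl (last t)) \<le> cpot \<Phi> (Inr t) + \<eta>"
    using t by (simp_all add: cpot_def last k_def)
qed

lemma cpot_Lipschitz:
  assumes \<Phi>: "\<And>v. \<Phi> v \<in> R" "\<And>u v. \<Phi> v \<le> \<Phi> u + dV u v"
  shows "walk cedge a b s \<Longrightarrow> cpot \<Phi> b \<le> cpot \<Phi> a + s"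
proof (erule cgraph.walk_Lipschitz[rotated 2])
  show "cpot \<Phi> a \<in> R" for a
    by (auto simp: cpot_def \<Phi> zero_R intro: psi_R split: sum.split)
  have pre: "cpot \<Phi> (Inr t) \<le> cpot \<Phi> (Inr (take (Suc i) t)) + e i (length t - 1) \<and>
      cpot \<Phi> (Inr (take (Suc i) t)) \<le> cpot \<Phi> (Inr t) + e i (length t - 1)"
    if t: "branch t" "i < length t" for t i
  proof -
    have "i \<le> length t - 1" using t by simp
    then show ?thesis unfolding cpot_take[OF t]
      using psi_Lipschitz[of "\<lambda>j. \<Phi> (t ! j)" i "length t - 1"] \<Phi>(1) t by (simp add: cpot_def)
  qed
  fix a b r assume "cedge a b r"
  then show "cpot \<Phi> b \<le> cpot \<Phi> a + r"
  proof cases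
    case (1 u v)
    then show ?thesis using \<Phi>(2) by (simp add: cpot_def)
  qed (use pre cpot_close[OF \<Phi>] in auto)
qed

lemma wdist_cedge_last: "branch t \<Longrightarrow> wdist cedge (Inr t) (Inl (last t)) \<le> \<eta>"
  by (intro cgraph.wdist_le_edge cedge.intros)

lemma wdist_cedge_take:
  assumes t: "branch t" and i: "i < length t"
  shows "wdist cedge (Inr (take (Suc i) t)) (Inr t) = e i (length t - 1)"
proof (rule antisym)
  show "wdist cedge (Inr (take (Suc i) t)) (Inr t) \<le> e i (length t - 1)"
    by (intro cgraph.wdist_le_edge cedge.intros assms)
  \<comment> \<open>The potential extends the function \<open>e i j\<close> from the entries
    \<open>t ! j\<close> to all of \<open>'v\<close>. It is designed to be 0 at the copy of entry
    \<open>i\<close> and \<open>e i (length t - 1)\<close> at the copy of the last one.\<close>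
  define A where "A u = (\<lambda>j. e i j \<oplus> dV u (t ! j)) ` {..<length t}" for u
  define \<Phi> where "\<Phi> u = Min (A u)" for u
  have A: "finite (A u)" "A u \<noteq> {}" for u using i by (auto simp: A_def)
  have \<Phi>A: "\<Phi> u \<in> A u" for u unfolding \<Phi>_def by (intro Min_in A)
  have \<Phi>_le: "\<Phi> u \<le> e i j \<oplus> dV u (t ! j)" if "j < length t" for u j
    unfolding \<Phi>_def using that by (intro Min_le A) (auto simp: A_def)
  have \<Phi>_R: "\<Phi> u \<in> R" for u using \<Phi>A[of u] oplus_in[OF e_R dV_R] by (auto simp: A_def)
  have \<Phi>_Lip: "\<Phi> v \<le> \<Phi> u + dV u v" for u v
  proof -
    obtain j where j: "j < length t" "\<Phi> u = e i j \<oplus> dV u (t ! j)" using \<Phi>A[of u] by (auto simp: A_def)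
    have "\<Phi> v \<le> e i j \<oplus> dV v (t ! j)" using \<Phi>_le[OF j(1)] .
    also have "\<dots> \<le> e i j \<oplus> (dV u (t ! j) \<oplus> dV u v)"
      using dV_oplus[of v "t ! j" u] by (intro oplus_mono e_R dV_R) (auto simp: oplus_commute dV_sym[of v])
    also have "\<dots> = (e i j \<oplus> dV u (t ! j)) \<oplus> dV u v" by (simp add: oplus_assoc e_R dV_R)
    also have "\<dots> \<le> \<Phi> u + dV u v" unfolding j(2) by (intro oplus_le oplus_in e_R dV_R)
    finally show ?thesis .
  qed
  have \<Phi>t: "\<Phi> (t ! j) = e i j" if j: "j < length t" for j
  proof (rule antisym)
    show "\<Phi> (t ! j) \<le> e i j" using \<Phi>_le[OF j, of "t ! j"] by (simp add: dV_self oplus_zero e_R)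
    obtain l where l: "l < length t" "\<Phi> (t ! j) = e i l \<oplus> dV (t ! j) (t ! l)" using \<Phi>A[of "t ! j"] by (auto simp: A_def)
    \<comment> \<open>Here the upward rounding is used: distances along the branch are not below the
      exact ones, so no other entry lowers the minimum.\<close>
    have "e j l \<le> dV (t ! j) (t ! l)" using t j l by (simp add: branch_def)
    then have "e i j \<le> e i l + dV (t ! j) (t ! l)" using e_triangle[of i j l] e_sym[of l j] by linarith
    then show "e i j \<le> \<Phi> (t ! j)" unfolding l(2) by (intro oplus_ge e_R)
  qed
  \<comment> \<open>The values \<open>e i j\<close> already satisfy the Lipschitz condition, so
    clamping leaves them unchanged.\<close>
  have psi: "psi (\<lambda>j. \<Phi> (t ! j)) j = e i j" if "j < length t" for j
    using that
  proof (induction j rule: less_induct)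
    case (less j)
    show ?case
    proof (rule antisym)
      show "psi (\<lambda>j. \<Phi> (t ! j)) j \<le> e i j"
      proof (rule psi_upper)
        fix l assume "l < j"
        then show "lo (psi (\<lambda>j. \<Phi> (t ! j)) l) (e l j) \<le> e i j"
          using less e_triangle[of i l j] e_sym[of j l] by (auto intro!: lo_le e_R)
      qed (use \<Phi>t less in simp)
      show "e i j \<le> psi (\<lambda>j. \<Phi> (t ! j)) j"
        by (rule psi_lower) (use \<Phi>t less e_oplus in auto)
    qed
  qed
  show "e i (length t - 1) \<le> wdist cedge (Inr (take (Suc i) t)) (Inr t)"
  proof (rule cgraph.wdist_ge[OF e_R])
    fix s assume "walk cedge (Inr (take (Suc i) t)) (Inr t) s"
    from cpot_Lipschitz[OF \<Phi>_R \<Phi>_Lip this]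
    have "cpot \<Phi> (Inr t) \<le> s" using psi[OF i] by (simp add: cpot_take[OF t i] e_self)
    moreover have "length t - 1 < length t" using i by linarith
    then have "cpot \<Phi> (Inr t) = e i (length t - 1)" using psi[of "length t - 1"] t by (simp add: cpot_def)
    ultimately show "e i (length t - 1) \<le> s" by simp
  qed
qed

end

section \<open>Bounded separable homogeneous universal spaces\<close>

locale homogeneous_universal =
  fixes M :: "'a metric"
  assumes bounded_M: "Metric_space.mbounded (mspace M) (mdist M) (mspace M)"
    and uncountable_M: "uncountable (mspace M)"
    and separable_M: "separable_space (mtopology_of M)"
    and complete_M: "mcomplete_of M"
    and homogeneous_M: "homogeneous_metric M"
    and universal_M: "universal_metric M"
begin

abbreviation "d \<equiv> mdist M"

sublocale Metric_space "mspace M" "mdist M"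
  by simp

section \<open>Finite extensions from homogeneity and universality\<close>

lemma dist_in: "x \<in> mspace M \<Longrightarrow> y \<in> mspace M \<Longrightarrow> d x y \<in> dist_set M"
  unfolding dist_set_def by blast

lemma dist_set_nonneg: "r \<in> dist_set M \<Longrightarrow> 0 \<le> r"
  by (auto simp: dist_set_def)

lemma mspace_nonempty: obtains x where "x \<in> mspace M"
  using uncountable_M by (metis countable_empty ex_in_conv)

lemma zero_in_dist_set: "0 \<in> dist_set M"
  by (metis mspace_nonempty dist_in mdist_zero)

text \<open>Universality realises the extended space somewhere in \<open>M\<close>, and homogeneity
  moves the copy of \<open>P\<close> back onto \<open>P\<close>. Positive \<open>c\<close> keeps the
  new point apart from \<open>P\<close>.\<close>

lemma one_point_extension_positive:
  fixes c :: "'a \<Rightarrow> real"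
  assumes P: "finite P" "P \<subseteq> mspace M" and c: "\<And>x. x \<in> P \<Longrightarrow> c x \<in> dist_set M \<and> 0 < c x"
    and compat: "\<And>x y. x \<in> P \<Longrightarrow> y \<in> P \<Longrightarrow> \<bar>c x - c y\<bar> \<le> d x y \<and> d x y \<le> c x + c y"
  shows "\<exists>z\<in>mspace M. \<forall>x\<in>P. d z x = c x"
proof -
  define D where "D u v = (case (u, v) of (None, None) \<Rightarrow> 0 | (None, Some y) \<Rightarrow> c y
    | (Some x, None) \<Rightarrow> c x | (Some x, Some y) \<Rightarrow> d x y)" for u v
  define C where "C = insert None (Some ` P)"
  have D: "D None None = 0" "D None (Some y) = c y" "D (Some x) None = c x" "D (Some x) (Some y) = d x y" for x y
    by (simp_all add: D_def)
  have C_cases: "u = None \<or> (\<exists>x\<in>P. u = Some x)" if "u \<in> C" for u using that by (auto simp: C_def)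
  \<comment> \<open>Nonnegativity and symmetry are demanded for all arguments, and \<open>c\<close>
    is uncontrolled outside \<open>P\<close>; hence the value 0 off \<open>C\<close>.\<close>
  define D' where "D' u v = (if u \<in> C \<and> v \<in> C then D u v else 0)" for u v
  have C_D': "D' u v = D u v" if "u \<in> C" "v \<in> C" for u v using that by (simp add: D'_def)
  have ms: "Metric_space C D'"
  proof
    fix u v w
    show "0 \<le> D' u v" using C_cases[of u] C_cases[of v] c by (auto simp: D'_def D less_imp_le)
    show "D' u v = D' v u" using C_cases[of u] C_cases[of v] by (auto simp: D'_def D commute)
    show "D' u v = 0 \<longleftrightarrow> u = v" if uv: "u \<in> C" "v \<in> C"
      using C_cases[OF uv(1)] C_cases[OF uv(2)] P(2) c by (force simp: C_D'[OF uv] D subset_iff)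
    show "D' u w \<le> D' u v + D' v w" if uvw: "u \<in> C" "v \<in> C" "w \<in> C"
    proof -
      have tri: "d x z \<le> d x y + d y z" if "x \<in> P" "y \<in> P" "z \<in> P" for x y z
        using that P(2) triangle by blast
      have c1: "c x \<le> c y + d x y" "c x \<le> d x y + c y" "c x \<le> d y x + c y" "c x \<le> c y + d y x"
        if "x \<in> P" "y \<in> P" for x y
        using compat[OF that] commute[of x y] by auto
      show ?thesis unfolding C_D'[OF uvw(1,3)] C_D'[OF uvw(1,2)] C_D'[OF uvw(2,3)]
        using C_cases[OF uvw(1)] C_cases[OF uvw(2)] C_cases[OF uvw(3)] c compat
        by (elim disjE bexE) (auto simp: D less_imp_le tri c1)
    qed
  qed
  define F where "F = metric (C, D')"
  have F: "mspace F = C" "mdist F = D'"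
    using ms by (simp_all add: F_def Metric_space.mspace_metric Metric_space.mdist_metric)
  have "dist_set F \<subseteq> dist_set M"
  proof
    fix r assume "r \<in> dist_set F"
    then obtain u v where uv: "u \<in> C" "v \<in> C" "r = D u v" by (auto simp: dist_set_def F C_D')
    then show "r \<in> dist_set M"
      using C_cases[OF uv(1)] C_cases[OF uv(2)] c P(2) zero_in_dist_set
      by (auto simp: D intro!: dist_in)
  qed
  moreover have "finite (mspace F)" using P(1) by (simp add: F C_def)
  ultimately obtain f where f: "isometric_embedding F M f"
    using universal_metric_embeds[OF universal_M] by blast
  have fX: "f u \<in> mspace M" if "u \<in> C" for u using f that by (auto simp: isometric_embedding_def F)
  have fd: "d (f u) (f v) = D u v" if "u \<in> C" "v \<in> C" for u v
    using f that by (simp add: isometric_embedding_def F C_D')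
  have PC: "None \<in> C" "\<And>x. x \<in> P \<Longrightarrow> Some x \<in> C" by (auto simp: C_def)
  define h where "h = inv_into P (f \<circ> Some)"
  have "inj_on (f \<circ> Some) P"
  proof (rule inj_onI)
    fix x y assume xy: "x \<in> P" "y \<in> P" "(f \<circ> Some) x = (f \<circ> Some) y"
    then have "d x y = d (f (Some x)) (f (Some x))" using fd[of "Some x" "Some y"] PC by (simp add: D)
    also have "\<dots> = 0" using fX PC xy by simp
    finally show "x = y" using zero[of x y] xy P(2) by blast
  qed
  then have h: "h (f (Some x)) = x" if "x \<in> P" for x
    using inv_into_f_f[of "f \<circ> Some" P x] that by (simp add: h_def)
  define A where "A = f ` Some ` P"
  have A: "finite A" "A \<subseteq> mspace M" using P(1) fX PC by (auto simp: A_def)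
  have "h ` A = P" using h by (force simp: A_def)
  then have "h ` (A \<inter> mspace M) = P \<inter> mspace M" using A P(2) by (simp add: Int_absorb2)
  then have "isometry_onto (submetric M A) (submetric M P) h"
    using P(2) PC by (auto simp: isometry_onto_def isometric_embedding_def A_def h fd D)
  then obtain g where g: "isometry_onto M M g" "\<forall>x\<in>A. g x = h x"
    using homogeneous_M[unfolded homogeneous_metric_def, rule_format, of A P h] A P(2) by blast
  have gX: "g x \<in> mspace M" "d (g x) (g y) = d x y" if "x \<in> mspace M" "y \<in> mspace M" for x y
    using g(1) that by (auto simp: isometry_onto_def isometric_embedding_def)
  show ?thesis
  proof (intro bexI ballI)
    show z: "g (f None) \<in> mspace M" using gX fX PC by blast
    fix x assume x: "x \<in> P"
    then have "g (f (Some x)) = x" using g(2) h by (auto simp: A_def)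
    then have "d (g (f None)) x = d (f None) (f (Some x))" using gX(2)[of "f None" "f (Some x)"] fX PC x by simp
    then show "d (g (f None)) x = c x" using fd PC x by (simp add: D)
  qed
qed

text \<open>Indexed points may coincide; compatibility makes \<open>c\<close> agree on coincident
  ones. A value 0 forces the existing point \<open>p j\<close> as witness.\<close>

lemma one_point_extension:
  fixes p :: "nat \<Rightarrow> 'a" and c :: "nat \<Rightarrow> real"
  assumes p: "\<And>j. j < n \<Longrightarrow> p j \<in> mspace M" and c: "\<And>j. j < n \<Longrightarrow> c j \<in> dist_set M"
    and compat: "\<And>i j. i < n \<Longrightarrow> j < n \<Longrightarrow> \<bar>c i - c j\<bar> \<le> d (p i) (p j) \<and> d (p i) (p j) \<le> c i + c j"
  shows "\<exists>z\<in>mspace M. \<forall>j<n. d z (p j) = c j"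
proof (cases "\<exists>j<n. c j = 0")
  case True
  then obtain j where j: "j < n" "c j = 0" by blast
  have "d (p j) (p i) = c i" if "i < n" for i
    using compat[OF j(1) that] j(2) dist_set_nonneg[OF c[OF that]] by simp
  then show ?thesis using p[OF j(1)] by blast
next
  case False
  define idx where "idx x = (SOME j. j < n \<and> p j = x)" for x
  have idx: "idx x < n \<and> p (idx x) = x" if "x \<in> p ` {..<n}" for x
    unfolding idx_def by (rule someI_ex) (use that in auto)
  have ci: "c (idx (p j)) = c j" if "j < n" for j
  proof -
    have i: "idx (p j) < n" "p (idx (p j)) = p j" using idx[of "p j"] that by auto
    have "\<bar>c (idx (p j)) - c j\<bar> \<le> d (p j) (p j)" using compat[OF i(1) that] i(2) by simp
    then show ?thesis using p[OF that] by simp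
  qed
  have "\<exists>z\<in>mspace M. \<forall>x\<in>p ` {..<n}. d z x = c (idx x)"
  proof (rule one_point_extension_positive)
    fix x y assume xy: "x \<in> p ` {..<n}" "y \<in> p ` {..<n}"
    show "\<bar>c (idx x) - c (idx y)\<bar> \<le> d x y \<and> d x y \<le> c (idx x) + c (idx y)"
      using compat[of "idx x" "idx y"] idx[OF xy(1)] idx[OF xy(2)] by simp
    show "c (idx x) \<in> dist_set M \<and> 0 < c (idx x)"
      using c dist_set_nonneg idx[OF xy(1)] False by (metis order_le_less)
  qed (use p in auto)
  then show ?thesis using ci by (metis imageI lessThan_iff)
qed

lemma point_at_distance:
  assumes "x \<in> mspace M" "a \<in> dist_set M"
  obtains z where "z \<in> mspace M" "d z x = a"
  using one_point_extension[of 1 "\<lambda>_. x" "\<lambda>_. a"] assms dist_set_nonneg[OF assms(2)] by auto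

lemma triangle_completion:
  assumes x: "x \<in> mspace M" "y \<in> mspace M" and a: "a \<in> dist_set M" "b \<in> dist_set M"
    and "a \<le> b + d x y" "b \<le> a + d x y" "d x y \<le> a + b"
  obtains z where "z \<in> mspace M" "d z x = a" "d z y = b"
proof -
  have "\<exists>z\<in>mspace M. \<forall>j<2. d z ((\<lambda>j::nat. if j = 0 then x else y) j) = (\<lambda>j. if j = 0 then a else b) j"
    by (rule one_point_extension) (use assms dist_set_nonneg commute[of x y] in auto)
  then obtain z where z: "z \<in> mspace M" "\<forall>j<2. d z (if j = (0::nat) then x else y) = (if j = 0 then a else b)"
    by blast
  from z(2) have "d z x = a" "d z y = b" by (force dest: spec[of _ 0], force dest: spec[of _ 1])
  then show ?thesis using that z(1) by blast
qed

section \<open>Consequences of separability and completeness\<close>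

lemma countable_dense:
  obtains C where "countable C" "C \<subseteq> mspace M" "\<And>x r. x \<in> mspace M \<Longrightarrow> 0 < r \<Longrightarrow> \<exists>y\<in>C. d x y < r"
proof -
  obtain C where C: "countable C" "C \<subseteq> mspace M" "mtopology closure_of C = mspace M"
    using separable_M unfolding separable_space_def by (auto simp: mtopology_of_def)
  have "\<exists>y\<in>C. d x y < r" if "x \<in> mspace M" "0 < r" for x r
    using that C(3) unfolding metric_closure_of by fastforce
  then show ?thesis using that C by blast
qed

lemma small_distance:
  assumes "0 < \<epsilon>"
  shows "\<exists>s\<in>dist_set M. 0 < s \<and> s < \<epsilon>"
proof (rule ccontr)
  assume "\<not> ?thesis"
  then have no: "\<not> (0 < s \<and> s < \<epsilon>)" if "s \<in> dist_set M" for s using that by blast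
  obtain C where C: "countable C" "C \<subseteq> mspace M" "\<And>x r. x \<in> mspace M \<Longrightarrow> 0 < r \<Longrightarrow> \<exists>y\<in>C. d x y < r"
    using countable_dense by blast
  have "mspace M \<subseteq> C"
  proof
    fix x assume x: "x \<in> mspace M"
    then obtain y where y: "y \<in> C" "d x y < \<epsilon>" using C(3) assms by blast
    then have "\<not> 0 < d x y" using no[OF dist_in[of x y]] x C(2) by blast
    then have "x = y" using mdist_pos_less[of x y] x y(1) C(2) by blast
    then show "x \<in> C" using y by simp
  qed
  then show False using C(1) uncountable_M countable_subset by blast
qed

lemma geometric_limit:
  assumes z: "\<And>n. z n \<in> mspace M" and C: "\<And>m n. m \<le> n \<Longrightarrow> d (z m) (z n) \<le> C * (1/2) ^ m"
  obtains l where "l \<in> mspace M" "(\<lambda>n. d (z n) l) \<longlonglongrightarrow> 0"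
proof -
  have lim: "(\<lambda>m. C * (1/2) ^ m) \<longlonglongrightarrow> 0"
    by (intro tendsto_mult_right_zero LIMSEQ_power_zero) simp
  have "MCauchy z"
    unfolding MCauchy_def
  proof (intro conjI allI impI)
    show "range z \<subseteq> mspace M" using z by auto
    fix \<epsilon> :: real assume "0 < \<epsilon>"
    then have "eventually (\<lambda>m. C * (1/2) ^ m < \<epsilon>) sequentially" using lim by (rule order_tendstoD(2)[rotated])
    then obtain N where N: "\<And>m. m \<ge> N \<Longrightarrow> C * (1/2) ^ m < \<epsilon>" by (auto simp: eventually_sequentially)
    have "d (z m) (z n) < \<epsilon>" if "N \<le> m" "N \<le> n" for m n
      using C[of m n] C[of n m] N[OF that(1)] N[OF that(2)] commute[of "z m" "z n"] by (cases "m \<le> n") auto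
    then show "\<exists>N. \<forall>n n'. N \<le> n \<longrightarrow> N \<le> n' \<longrightarrow> d (z n) (z n') < \<epsilon>" by blast
  qed
  then obtain l where "limitin mtopology z l sequentially"
    using complete_M unfolding mcomplete_of_def mcomplete_def by blast
  then show ?thesis using that unfolding limitin_metric_dist_null by blast
qed

lemma dist_tendsto:
  assumes "\<And>n. z n \<in> mspace M" "\<And>n. w n \<in> mspace M" "l \<in> mspace M" "k \<in> mspace M"
    and "(\<lambda>n. d (z n) l) \<longlonglongrightarrow> 0" "(\<lambda>n. d (w n) k) \<longlonglongrightarrow> 0"
  shows "(\<lambda>n. d (z n) (w n)) \<longlonglongrightarrow> d l k"
proof (rule Lim_transform2[OF tendsto_const])
  have le: "norm (d l k - d (z n) (w n)) \<le> d (z n) l + d (w n) k" for n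
  proof -
    have "d l k \<le> d (z n) l + (d (z n) (w n) + d (w n) k)"
      using triangle[of l "z n" k] triangle[of "z n" "w n" k] assms(1-4) commute[of l "z n"] by simp
    moreover have "d (z n) (w n) \<le> d (z n) l + (d l k + d (w n) k)"
      using triangle[of "z n" l "w n"] triangle[of l k "w n"] assms(1-4) commute[of k "w n"] by simp
    ultimately show ?thesis unfolding real_norm_def by linarith
  qed
  have "(\<lambda>n. d (z n) l + d (w n) k) \<longlonglongrightarrow> 0" using tendsto_add[OF assms(5,6)] by simp
  then show "(\<lambda>n. d l k - d (z n) (w n)) \<longlonglongrightarrow> 0"
    by (rule Lim_null_comparison[OF always_eventually[OF allI[OF le]]])
qed

text \<open>The limit is realised by points \<open>z n\<close> with distances \<open>t n\<close> to
  a fixed \<open>x\<close>, where \<open>t n\<close> tends to \<open>r\<close> and consecutive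
  points are at small distances \<open>s n\<close>, so that the \<open>z n\<close> converge.\<close>

lemma closed_dist_set: "closed (dist_set M)"
  unfolding closed_sequential_limits
proof (intro allI impI, elim conjE)
  fix q r assume q: "\<forall>n. q n \<in> dist_set M" and lim: "q \<longlonglongrightarrow> r"
  have "0 \<le> r" using lim q dist_set_nonneg by (intro LIMSEQ_le_const) auto
  show "r \<in> dist_set M"
  proof (cases "r = 0")
    case False
    with \<open>0 \<le> r\<close> have r: "0 < r" by simp
    have "\<exists>s. s \<in> dist_set M \<and> 0 < s \<and> s < r \<and> s < (1/2) ^ n" for n
      using small_distance[of "min r ((1/2) ^ n)"] r by auto
    then obtain s where s: "\<And>n. s n \<in> dist_set M" "\<And>n. 0 < s n" "\<And>n. s n < r" "\<And>n. s n < (1/2) ^ n" by metis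
    \<comment> \<open>Both \<open>t n\<close> and \<open>t (Suc n)\<close> must be within
      \<open>s n / 2\<close> of \<open>r\<close>, so that with \<open>s n\<close> they form a
      triangle; \<open>s n < r\<close> gives the remaining inequality.\<close>
    have "\<exists>q'. q' \<in> dist_set M \<and> (\<forall>i\<le>n. \<bar>q' - r\<bar> < s i / 2)" for n
    proof -
      define \<delta> where "\<delta> = Min (s ` {..n})"
      have \<delta>: "0 < \<delta>" "\<And>i. i \<le> n \<Longrightarrow> \<delta> \<le> s i" using s by (auto simp: \<delta>_def)
      have "eventually (\<lambda>n. dist (q n) r < \<delta> / 2) sequentially"
        using lim \<delta>(1) by (intro tendstoD) auto
      then obtain m where "\<bar>q m - r\<bar> < \<delta> / 2" by (auto simp: eventually_sequentially dist_real_def)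
      then show ?thesis using q \<delta>(2) by (intro exI[of _ "q m"]) fastforce
    qed
    then obtain t where t: "\<And>n. t n \<in> dist_set M" "\<And>n i. i \<le> n \<Longrightarrow> \<bar>t n - r\<bar> < s i / 2" by metis
    obtain x where x: "x \<in> mspace M" using mspace_nonempty by blast
    have "\<exists>z. \<forall>n. (z n \<in> mspace M \<and> d (z n) x = t n) \<and> d (z (Suc n)) (z n) = s n"
    proof (rule dependent_nat_choice)
      show "\<exists>z. z \<in> mspace M \<and> d z x = t 0" using point_at_distance[OF x t(1)] by metis
      fix z n assume z: "z \<in> mspace M \<and> d z x = t n"
      have "\<bar>t n - r\<bar> < s n / 2" "\<bar>t (Suc n) - r\<bar> < s n / 2" using t(2)[of n n] t(2)[of n "Suc n"] by auto
      then have "t (Suc n) \<le> s n + d x z" "s n \<le> t (Suc n) + d x z" "d x z \<le> t (Suc n) + s n"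
        using z s(2,3)[of n] commute[of x z] by linarith+
      then obtain z' where "z' \<in> mspace M" "d z' x = t (Suc n)" "d z' z = s n"
        using triangle_completion[of x z "t (Suc n)" "s n"] x z t(1) s(1) by blast
      then show "\<exists>z'. (z' \<in> mspace M \<and> d z' x = t (Suc n)) \<and> d z' z = s n" by blast
    qed
    then obtain z where z: "\<And>n. z n \<in> mspace M" "\<And>n. d (z n) x = t n" "\<And>n. d (z (Suc n)) (z n) = s n" by blast
    \<comment> \<open>The right side is the sum of \<open>(1/2) ^ i\<close> over
      \<open>m \<le> i < n\<close>.\<close>
    have bound: "d (z m) (z n) \<le> 2 * (1/2) ^ m - 2 * (1/2) ^ n" if "m \<le> n" for m n
      using that
    proof (induction rule: dec_induct)
      case (step n)
      then show ?case using triangle[of "z m" "z n" "z (Suc n)"] z s(4)[of n] commute[of "z n" "z (Suc n)"] by simp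
    qed (use z in simp)
    have "d (z m) (z n) \<le> 2 * (1/2) ^ m" if "m \<le> n" for m n
      using bound[OF that] zero_le_power[of "1/2::real" n] by linarith
    then obtain l where l: "l \<in> mspace M" "(\<lambda>n. d (z n) l) \<longlonglongrightarrow> 0"
      using geometric_limit[of z 2] z(1) by blast
    have "(\<lambda>n. d (z n) x) \<longlonglongrightarrow> d l x"
      by (rule dist_tendsto[OF z(1) _ l(1) x l(2)]) (use x in auto)
    moreover have "t \<longlonglongrightarrow> r"
    proof (rule Lim_transform2[OF tendsto_const])
      have "norm (r - t n) \<le> (1/2) ^ n" for n unfolding real_norm_def using t(2)[of n n] s(4)[of n] s(2)[of n] by linarith
      then show "(\<lambda>n. r - t n) \<longlonglongrightarrow> 0"
        by (intro Lim_null_comparison[OF always_eventually LIMSEQ_power_zero[of "1/2"]]) auto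
    qed
    ultimately have "d l x = r" using LIMSEQ_unique z(2) by (metis (no_types, lifting) ext)
    then show ?thesis using dist_in[OF l(1) x] by simp
  qed (use zero_in_dist_set in simp)
qed

lemma max_dist_le:
  assumes "a \<in> dist_set M" "b \<in> dist_set M"
  shows "Sup {r \<in> dist_set M. r \<le> a + b} \<in> dist_set M" "Sup {r \<in> dist_set M. r \<le> a + b} \<le> a + b"
    "a \<le> Sup {r \<in> dist_set M. r \<le> a + b}" "b \<le> Sup {r \<in> dist_set M. r \<le> a + b}"
proof -
  let ?A = "{r \<in> dist_set M. r \<le> a + b}"
  have "?A = dist_set M \<inter> {..a + b}" by auto
  then have cl: "closed ?A" using closed_Int[OF closed_dist_set closed_atMost] by simp
  have ab: "a \<in> ?A" "b \<in> ?A" using assms dist_set_nonneg by auto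
  have bdd: "bdd_above ?A" by (auto intro: bdd_aboveI)
  have "Sup ?A \<in> ?A" using closed_contains_Sup[OF _ bdd cl] ab(1) by blast
  then show "Sup ?A \<in> dist_set M" "Sup ?A \<le> a + b" by auto
  show "a \<le> Sup ?A" "b \<le> Sup ?A" using cSup_upper[OF ab(1) bdd] cSup_upper[OF ab(2) bdd] .
qed

text \<open>For \<open>amalg\<close>, two triangles are glued along a side
  \<open>s = a \<oplus> b\<close>: sides \<open>a, b, s\<close> with apex \<open>x1\<close>, and
  \<open>q, c, s\<close> with apex \<open>x3\<close>. The distance between the apices is at most
  \<open>b \<oplus> c\<close> by one path and at least \<open>q - a\<close> by the other.\<close>

sublocale distance_set "dist_set M"
proof
  show "bdd_above (dist_set M)"
  proof -
    obtain B where "\<forall>x\<in>mspace M. \<forall>y\<in>mspace M. d x y \<le> B" using bounded_M unfolding mbounded_alt by blast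
    then show ?thesis by (intro bdd_aboveI[of _ B]) (auto simp: dist_set_def)
  qed
  fix a b c assume abc: "a \<in> dist_set M" "b \<in> dist_set M" "c \<in> dist_set M"
  define s where "s = Sup {r \<in> dist_set M. r \<le> a + b}"
  define q where "q = Sup {r \<in> dist_set M. r \<le> s + c}"
  have s: "s \<in> dist_set M" "s \<le> a + b" "a \<le> s" "b \<le> s"
    using max_dist_le[OF abc(1,2)] by (simp_all add: s_def)
  have q: "q \<in> dist_set M" "q \<le> s + c" "s \<le> q" "c \<le> q"
    using max_dist_le[OF s(1) abc(3)] by (simp_all add: q_def)
  have nn: "0 \<le> a" "0 \<le> b" "0 \<le> c" using abc dist_set_nonneg by auto
  obtain x0 where x0: "x0 \<in> mspace M" using mspace_nonempty by blast
  obtain x2 where x2: "x2 \<in> mspace M" "d x2 x0 = s" using point_at_distance[OF x0 s(1)] by blast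
  obtain x1 where x1: "x1 \<in> mspace M" "d x1 x2 = b" "d x1 x0 = a"
    using triangle_completion[OF x2(1) x0 abc(2,1)] x2 s nn by auto
  obtain x3 where x3: "x3 \<in> mspace M" "d x3 x2 = c" "d x3 x0 = q"
    using triangle_completion[OF x2(1) x0 abc(3) q(1)] x2 s nn q by auto
  have "d x1 x3 \<le> b + c" using triangle[of x1 x2 x3] x1 x2 x3 commute[of x2 x3] by simp
  then have "d x1 x3 \<le> Sup {r \<in> dist_set M. r \<le> b + c}"
    using dist_in[OF x1(1) x3(1)] by (intro cSup_upper) (auto intro: bdd_aboveI)
  moreover have "q \<le> a + d x1 x3" using triangle[of x3 x1 x0] x0 x1 x3 commute[of x3 x1] by simp
  ultimately show "Sup {r \<in> dist_set M. r \<le> Sup {r \<in> dist_set M. r \<le> a + b} + c}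
      \<le> a + Sup {r \<in> dist_set M. r \<le> b + c}"
    by (simp add: q_def s_def)
qed (use closed_dist_set zero_in_dist_set dist_set_nonneg in auto)

section \<open>Countable subspaces and dense sequences\<close>

lemma countable_pseudometric_embeds:
  fixes D :: "'c \<Rightarrow> 'c \<Rightarrow> real"
  assumes C: "countable C" and D: "\<And>u v. D u v \<in> dist_set M" "\<And>u. D u u = 0" "\<And>u v. D u v = D v u"
    "\<And>u v w. D u w \<le> D u v + D v w"
  shows "\<exists>\<iota>. (\<forall>u\<in>C. \<iota> u \<in> mspace M) \<and> (\<forall>u\<in>C. \<forall>v\<in>C. d (\<iota> u) (\<iota> v) = D u v)"
proof -
  define D' where "D' i j = D (from_nat_into C i) (from_nat_into C j)" for i j
  \<comment> \<open>Points are placed one at a time; \<open>one_point_extension\<close> admits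
    coincidences, so a pseudometric suffices.\<close>
  have "\<exists>y. \<forall>n. y n \<in> mspace M \<and> (\<forall>j<n. d (y n) (y j) = D' n j)"
  proof (rule dependent_wellorder_choice)
    fix n :: nat and y :: "nat \<Rightarrow> 'a"
    assume y: "\<And>m. m < n \<Longrightarrow> y m \<in> mspace M \<and> (\<forall>j<m. d (y m) (y j) = D' m j)"
    have yd: "d (y i) (y j) = D' i j" if "i < n" "j < n" for i j
    proof (cases i j rule: linorder_cases)
      case less
      then show ?thesis using y[OF that(2)] D(3) commute by (metis D'_def)
    qed (use y that D(2) in \<open>auto simp: D'_def\<close>)
    show "\<exists>z. z \<in> mspace M \<and> (\<forall>j<n. d z (y j) = D' n j)"
    proof -
      have "\<exists>z\<in>mspace M. \<forall>j<n. d z (y j) = D' n j"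
      proof (rule one_point_extension)
        fix i j assume ij: "i < n" "j < n"
        have "D' n i \<le> D' n j + D' i j" "D' n j \<le> D' n i + D' i j" "D' i j \<le> D' n i + D' n j"
          unfolding D'_def using D(3,4) by metis+
        then show "\<bar>D' n i - D' n j\<bar> \<le> d (y i) (y j) \<and> d (y i) (y j) \<le> D' n i + D' n j"
          unfolding yd[OF ij] by auto
      qed (use y D(1) in \<open>auto simp: D'_def\<close>)
      then show ?thesis by blast
    qed
  qed auto
  then obtain y where y: "\<And>n. y n \<in> mspace M" "\<And>n j. j < n \<Longrightarrow> d (y n) (y j) = D' n j" by blast
  have yd: "d (y i) (y j) = D' i j" for i j
  proof (cases i j rule: linorder_cases)
    case less
    then show ?thesis using y(2)[OF less] D(3) commute by (metis D'_def)
  qed (use y D(2) in \<open>auto simp: D'_def\<close>)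
  show ?thesis
    by (rule exI[of _ "y \<circ> to_nat_on C"]) (use y(1) C in \<open>auto simp: yd D'_def\<close>)
qed

text \<open>The second conclusion, that \<open>y\<close> comes arbitrarily close to each image
  point, transfers estimates for \<open>f\<close> from the sequence to the copy.\<close>

lemma dense_isometry_extends:
  fixes x y :: "nat \<Rightarrow> 'a"
  assumes x: "\<And>n. x n \<in> mspace M" "\<And>z r. z \<in> mspace M \<Longrightarrow> 0 < r \<Longrightarrow> \<exists>n. d z (x n) < r"
    and y: "\<And>n. y n \<in> mspace M" "\<And>i j. d (y i) (y j) = d (x i) (x j)"
  shows "\<exists>g. isometric_embedding M M g \<and> (\<forall>z\<in>mspace M. \<forall>r>0. \<exists>n. d (y n) (g z) < r)"
proof -
  have "\<exists>l \<sigma>. l \<in> mspace M \<and> (\<lambda>n. d (y (\<sigma> n)) l) \<longlonglongrightarrow> 0 \<and> (\<lambda>n. d (x (\<sigma> n)) z) \<longlonglongrightarrow> 0"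
    if z: "z \<in> mspace M" for z
  proof -
    have "\<exists>k. d z (x k) < (1/2) ^ n" for n using x(2)[OF z, of "(1/2) ^ n"] by simp
    then obtain \<sigma> where \<sigma>: "\<And>n. d z (x (\<sigma> n)) < (1/2) ^ n" by metis
    have "d (y (\<sigma> m)) (y (\<sigma> n)) \<le> 2 * (1/2) ^ m" if "m \<le> n" for m n
    proof -
      have "d (x (\<sigma> m)) (x (\<sigma> n)) \<le> d z (x (\<sigma> m)) + d z (x (\<sigma> n))"
        using triangle[of "x (\<sigma> m)" z "x (\<sigma> n)"] x(1) z commute[of z "x (\<sigma> m)"] by simp
      moreover have "(1/2::real) ^ n \<le> (1/2) ^ m" using that by (intro power_decreasing) auto
      ultimately show ?thesis unfolding y(2) using \<sigma>[of m] \<sigma>[of n] by linarith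
    qed
    then obtain l where "l \<in> mspace M" "(\<lambda>n. d (y (\<sigma> n)) l) \<longlonglongrightarrow> 0"
      using geometric_limit[of "\<lambda>n. y (\<sigma> n)" 2] y(1) by blast
    moreover have "(\<lambda>n. d (x (\<sigma> n)) z) \<longlonglongrightarrow> 0"
    proof (rule Lim_null_comparison[OF always_eventually LIMSEQ_power_zero[of "1/2"]])
      show "\<forall>n. norm (d (x (\<sigma> n)) z) \<le> (1/2) ^ n"
        using \<sigma> commute[of z] by (simp add: less_imp_le)
    qed simp
    ultimately show ?thesis by blast
  qed
  then obtain g \<sigma> where g: "\<And>z. z \<in> mspace M \<Longrightarrow> g z \<in> mspace M"
    "\<And>z. z \<in> mspace M \<Longrightarrow> (\<lambda>n. d (y (\<sigma> z n)) (g z)) \<longlonglongrightarrow> 0"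
    "\<And>z. z \<in> mspace M \<Longrightarrow> (\<lambda>n. d (x (\<sigma> z n)) z) \<longlonglongrightarrow> 0"
    by metis
  show ?thesis
  proof (rule exI[of _ g], intro conjI allI ballI impI)
    have "d (g z) (g w) = d z w" if "z \<in> mspace M" "w \<in> mspace M" for z w
    proof (rule LIMSEQ_unique)
      show "(\<lambda>n. d (y (\<sigma> z n)) (y (\<sigma> w n))) \<longlonglongrightarrow> d (g z) (g w)"
        by (rule dist_tendsto[OF y(1) y(1) g(1)[OF that(1)] g(1)[OF that(2)] g(2)[OF that(1)] g(2)[OF that(2)]])
      show "(\<lambda>n. d (y (\<sigma> z n)) (y (\<sigma> w n))) \<longlonglongrightarrow> d z w"
        unfolding y(2) by (rule dist_tendsto[OF x(1) x(1) that g(3)[OF that(1)] g(3)[OF that(2)]])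
    qed
    then show "isometric_embedding M M g" using g(1) by (simp add: isometric_embedding_def)
    show "\<exists>n. d (y n) (g z) < r" if "z \<in> mspace M" "0 < r" for z r
      using order_tendstoD(2)[OF g(2)[OF that(1)] that(2)] by (auto simp: eventually_sequentially)
  qed
qed

text \<open>Injectivity makes distances between different indices positive, as the rounding
  requires.\<close>

lemma dense_sequence:
  "\<exists>x :: nat \<Rightarrow> 'a. inj x \<and> (\<forall>n. x n \<in> mspace M) \<and> (\<forall>z\<in>mspace M. \<forall>r>0. \<exists>n. d z (x n) < r)"
proof -
  obtain C where C: "countable C" "C \<subseteq> mspace M" "\<And>x r. x \<in> mspace M \<Longrightarrow> 0 < r \<Longrightarrow> \<exists>y\<in>C. d x y < r"
    using countable_dense by blast
  have "infinite C"
  proof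
    assume fin: "finite C"
    have "mspace M \<subseteq> C"
    proof
      fix z assume z: "z \<in> mspace M"
      show "z \<in> C"
      proof (rule ccontr)
        assume "z \<notin> C"
        moreover have "C \<noteq> {}" using C(3)[OF z, of 1] by auto
        ultimately have "0 < Min (d z ` C)" using fin z C(2) by (subst Min_gr_iff) auto
        then obtain c where c: "c \<in> C" "d z c < Min (d z ` C)" using C(3)[OF z] by blast
        moreover have "Min (d z ` C) \<le> d z c" using fin c(1) by (intro Min_le) auto
        ultimately show False by simp
      qed
    qed
    then show False using C(1) uncountable_M countable_subset by blast
  qed
  then have bij: "bij_betw (from_nat_into C) UNIV C" using bij_betw_from_nat_into C(1) by blast
  show ?thesis
  proof (rule exI[of _ "from_nat_into C"], intro conjI allI ballI impI)
    show "inj (from_nat_into C)" using bij by (rule bij_betw_imp_inj_on)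
    show "from_nat_into C n \<in> mspace M" for n using bij C(2) by (auto simp: bij_betw_def)
    show "\<exists>n. d z (from_nat_into C n) < r" if "z \<in> mspace M" "0 < r" for z r
      using C(3)[OF that] bij by (metis bij_betw_def imageE)
  qed
qed

end

section \<open>Nearly constant sequences and oscillation stability\<close>

context homogeneous_universal
begin

text \<open>\<open>w k\<close> codes \<open>x k\<close> by its rounded distances to the earlier
  points. The rounded triangle inequalities are exactly the edge conditions between codes, and
  substitution keeps them.\<close>

lemma rounded_words:
  assumes b: "\<And>n. set (b n) \<subseteq> insert 0 S" "\<And>n. 0 \<in> set (b n)"
    and S: "S \<subseteq> dist_set M" "\<And>s. s \<in> S \<Longrightarrow> 0 < s"
    and \<rho>: "\<And>r. r \<in> dist_set M \<Longrightarrow> 0 < r \<Longrightarrow> \<rho> r \<in> S"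
      "\<And>p q r. p \<in> dist_set M \<Longrightarrow> q \<in> dist_set M \<Longrightarrow> r \<in> dist_set M \<Longrightarrow>
        0 < p \<Longrightarrow> 0 < q \<Longrightarrow> 0 < r \<Longrightarrow> p \<le> q + r \<Longrightarrow> \<rho> p \<le> \<rho> q + \<rho> r"
    and x: "inj x" "\<And>n. x n \<in> mspace M"
    and w_def: "w = (\<lambda>k. map (\<lambda>i. \<rho> (d (x k) (x i))) [0..<k])"
  shows "set (w k) \<subseteq> S" "set (word_subst b (w k)) \<subseteq> S"
    "k < l \<Longrightarrow> wdist (word_edge S) (word_subst b (w k)) (word_subst b (w l)) = \<rho> (d (x k) (x l))"
proof -
  interpret word_graph "dist_set M" S using S by unfold_locales auto
  have pos: "d (x i) (x j) \<in> dist_set M" "0 < d (x i) (x j)" if "i \<noteq> j" for i j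
    using x that dist_in by (auto simp: inj_eq)
  have w: "set (w k) \<subseteq> S" for k using \<rho>(1) pos by (auto simp: w_def)
  show "set (w k) \<subseteq> S" by (rule w)
  show "set (word_subst b (w k)) \<subseteq> S" using S(2) b(1) w by (rule set_word_subst)
  assume kl: "k < l"
  have tri: "\<rho> (d (x i) (x j)) \<le> \<rho> (d (x i) (x m)) + \<rho> (d (x m) (x j))"
    if "i \<noteq> j" "i \<noteq> m" "m \<noteq> j" for i j m
    using pos that x(2) triangle by (intro \<rho>(2)) auto
  show "wdist (word_edge S) (word_subst b (w k)) (word_subst b (w l)) = \<rho> (d (x k) (x l))"
  proof (rule word_edge_geodesic, rule word_subst_edge)
    show "length (w k) < length (w l)" using kl by (simp add: w_def)
    show "w l ! length (w k) = \<rho> (d (x k) (x l))" using kl by (simp add: w_def commute)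
    fix i assume "i < length (w k)"
    then have i: "i < k" by (simp add: w_def)
    then have "w k ! i = \<rho> (d (x k) (x i))" "w l ! i = \<rho> (d (x l) (x i))" using kl by (simp_all add: w_def)
    then show "\<bar>w k ! i - w l ! i\<bar> \<le> \<rho> (d (x k) (x l)) \<and> \<rho> (d (x k) (x l)) \<le> w k ! i + w l ! i"
      using tri[of k i l] tri[of l i k] tri[of k l i] i kl commute by (simp add: abs_le_iff)
  qed (use S b w in auto)
qed

lemma homogeneous_sequence:
  fixes f :: "'a \<Rightarrow> real" and x :: "nat \<Rightarrow> 'a"
  assumes \<epsilon>: "0 < \<epsilon>" and bdd: "bounded (f ` mspace M)"
    and \<eta>: "\<eta> \<in> dist_set M" "0 < \<eta>"
    and uc: "\<And>y z. y \<in> mspace M \<Longrightarrow> z \<in> mspace M \<Longrightarrow> d y z \<le> \<eta> \<Longrightarrow> \<bar>f y - f z\<bar> < \<epsilon>"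
    and x: "inj x" "\<And>n. x n \<in> mspace M"
  shows "\<exists>y. (\<forall>n. y n \<in> mspace M) \<and> (\<forall>i j. d (y i) (y j) = d (x i) (x j)) \<and>
    (\<forall>i j. \<bar>f (y i) - f (y j)\<bar> < 3 * \<epsilon>)"
proof -
  obtain S \<rho> where S0: "finite S" "S \<subseteq> dist_set M" "\<forall>s\<in>S. 0 < s"
    and \<rho>: "\<forall>r\<in>dist_set M. 0 < r \<longrightarrow> \<rho> r \<in> S \<and> r \<le> \<rho> r \<and> \<rho> r \<le> r + \<eta>"
      "\<forall>p\<in>dist_set M. \<forall>q\<in>dist_set M. \<forall>r\<in>dist_set M. 0 < p \<and> 0 < q \<and> 0 < r \<and> p \<le> q + r \<longrightarrow> \<rho> p \<le> \<rho> q + \<rho> r"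
    using distance_rounding[OF \<eta>(2,1)] by (elim exE conjE) (rule that; assumption)
  note S = S0(1,2) S0(3)[rule_format]
  have \<rho>S: "\<rho> r \<in> S" if "r \<in> dist_set M" "0 < r" for r using \<rho>(1) that by blast
  have \<rho>\<eta>: "r \<le> \<rho> r \<and> \<rho> r \<le> r + \<eta>" if "r \<in> dist_set M" "0 < r" for r using \<rho>(1) that by blast
  have \<rho>_sub: "\<rho> p \<le> \<rho> q + \<rho> r" if "p \<in> dist_set M" "q \<in> dist_set M" "r \<in> dist_set M"
    "0 < p" "0 < q" "0 < r" "p \<le> q + r" for p q r using \<rho>(2) that by blast
  interpret W: word_graph "dist_set M" S using S by unfold_locales auto
  define e where "e i j = d (x i) (x j)" for i j
  interpret coupling "dist_set M" "wdist (word_edge S)" e \<eta>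
  proof
    show "wdist (word_edge S) u v = wdist (word_edge S) v u" for u v by (rule W.wdist_sym)
    show "e i j = e j i" for i j by (simp add: e_def commute)
  qed (use x(2) \<eta> W.wdist_in W.wdist_self W.wdist_triangle in \<open>auto simp: e_def dist_in triangle\<close>)
  \<comment> \<open>All lists of words are included because the branch is not yet known; finiteness
    of \<open>S\<close> keeps \<open>N\<close> countable.\<close>
  define N where "N = Inl ` lists S \<union> Inr ` lists (lists S)"
  have cN: "countable N" using S(1) by (simp add: N_def countable_finite)
  obtain \<iota> where \<iota>: "\<And>u. u \<in> N \<Longrightarrow> \<iota> u \<in> mspace M"
    "\<And>u v. u \<in> N \<Longrightarrow> v \<in> N \<Longrightarrow> d (\<iota> u) (\<iota> v) = wdist cedge u v"
    using countable_pseudometric_embeds[of N "wdist cedge", OF cN cgraph.wdist_in cgraph.wdist_self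
      cgraph.wdist_sym cgraph.wdist_triangle] by blast
  \<comment> \<open>Colours are intervals of values of length \<open>\<epsilon>\<close>; the default
    0 keeps the range finite where \<open>\<iota>\<close> is uncontrolled.\<close>
  define col where "col v = (if v \<in> lists S then \<lfloor>f (\<iota> (Inl v)) / \<epsilon>\<rfloor> else 0)" for v
  obtain B where B: "\<And>z. z \<in> mspace M \<Longrightarrow> \<bar>f z\<bar> \<le> B"
    using bdd by (auto simp: bounded_iff)
  have "finite (range col)"
  proof (rule finite_subset)
    show "range col \<subseteq> {\<lfloor>- B / \<epsilon>\<rfloor>..\<lfloor>B / \<epsilon>\<rfloor>} \<union> {0}"
    proof (rule image_subsetI)
      fix v
      have "\<lfloor>- B / \<epsilon>\<rfloor> \<le> \<lfloor>f (\<iota> (Inl v)) / \<epsilon>\<rfloor> \<and> \<lfloor>f (\<iota> (Inl v)) / \<epsilon>\<rfloor> \<le> \<lfloor>B / \<epsilon>\<rfloor>" if "v \<in> lists S"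
      proof -
        have "\<bar>f (\<iota> (Inl v))\<bar> \<le> B" using that by (intro B \<iota>) (auto simp: N_def)
        then show ?thesis using \<epsilon> by (intro conjI floor_mono divide_right_mono) auto
      qed
      then show "col v \<in> {\<lfloor>- B / \<epsilon>\<rfloor>..\<lfloor>B / \<epsilon>\<rfloor>} \<union> {0}" by (simp add: col_def)
    qed
  qed simp
  from word_Ramsey[OF S(1,3) this] obtain b k where
    b: "\<And>n. set (b n) \<subseteq> insert 0 S" "\<And>n. 0 \<in> set (b n)"
    and k: "\<And>w. set w \<subseteq> S \<Longrightarrow> col (word_subst b w) = k" by blast
  define w where "w = (\<lambda>k. map (\<lambda>i. \<rho> (d (x k) (x i))) [0..<k])"
  define v where "v n = word_subst b (w n)" for n
  have w: "set (w n) \<subseteq> S" for n by (rule rounded_words(1)[OF b S(2,3) \<rho>S \<rho>_sub x w_def])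
  have vS: "set (v n) \<subseteq> S" for n
    unfolding v_def by (rule rounded_words(2)[OF b S(2,3) \<rho>S \<rho>_sub x w_def])
  have v_less: "wdist (word_edge S) (v i) (v j) = \<rho> (e i j)" if "i < j" for i j
    unfolding v_def e_def by (rule rounded_words(3)[OF b S(2,3) \<rho>S \<rho>_sub x w_def that])
  have v: "e i j \<le> wdist (word_edge S) (v i) (v j) \<and> wdist (word_edge S) (v i) (v j) \<le> e i j + \<eta>" for i j
  proof -
    have *: "e i j \<le> \<rho> (e i j) \<and> \<rho> (e i j) \<le> e i j + \<eta>" if "i \<noteq> j" for i j
      unfolding e_def using x that dist_in by (intro \<rho>\<eta>) (auto simp: inj_eq)
    show ?thesis
    proof (cases i j rule: linorder_cases)
      case less
      then show ?thesis using *[of i j] by (simp add: v_less)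
    next
      case equal
      then show ?thesis using \<eta> by (simp add: W.wdist_self e_self)
    next
      case greater
      then show ?thesis using *[of j i] by (simp add: W.wdist_sym[of "v i"] v_less e_sym[of i])
    qed
  qed
  define t where "t n = map v [0..<Suc n]" for n
  have branch_t: "branch (t n)" for n
    using v by (simp add: branch_def t_def del: upt_Suc)
  have t: "last (t n) = v n" "length (t n) = Suc n" for n by (simp_all add: t_def)
  have vl: "v n \<in> lists S" for n using vS[of n] by (simp add: lists_eq_set)
  then have "t n \<in> lists (lists S)" for n by (auto simp: t_def lists_eq_set)
  with vl have tN: "Inr (t n) \<in> N" "Inl (v n) \<in> N" for n unfolding N_def by blast+
  define y where "y n = \<iota> (Inr (t n))" for n
  have y: "y n \<in> mspace M" for n unfolding y_def by (rule \<iota>(1)[OF tN(1)])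
  have y_le: "d (y i) (y j) = e i j" if "i \<le> j" for i j
  proof -
    \<comment> \<open>All \<open>t n\<close> lie on one branch of the tree, where the coupling gives
      exact distances.\<close>
    have "take (Suc i) (t j) = t i" using that by (simp add: t_def take_map del: upt_Suc)
    then show ?thesis using wdist_cedge_take[OF branch_t, of i j] that
      by (simp add: y_def \<iota>(2)[OF tN(1) tN(1)] t(2))
  qed
  have near: "\<bar>f (y n) - f (\<iota> (Inl (v n)))\<bar> < \<epsilon>" for n
  proof (rule uc[OF y \<iota>(1)[OF tN(2)]])
    show "d (y n) (\<iota> (Inl (v n))) \<le> \<eta>"
      using wdist_cedge_last[OF branch_t, of n] by (simp add: y_def \<iota>(2)[OF tN] t(1))
  qed
  have colour: "\<bar>f (\<iota> (Inl (v i))) - f (\<iota> (Inl (v j)))\<bar> < \<epsilon>" for i j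
  proof -
    have "\<lfloor>f (\<iota> (Inl (v i))) / \<epsilon>\<rfloor> = \<lfloor>f (\<iota> (Inl (v j))) / \<epsilon>\<rfloor>"
      using k[OF w[of i]] k[OF w[of j]] vl[of i] vl[of j] by (simp add: col_def flip: v_def)
    then have "\<bar>f (\<iota> (Inl (v i))) / \<epsilon> - f (\<iota> (Inl (v j))) / \<epsilon>\<bar> < 1" by linarith
    then show ?thesis using \<epsilon> by (simp add: diff_divide_distrib[symmetric] abs_divide)
  qed
  show ?thesis
  proof (intro exI conjI allI)
    show "y n \<in> mspace M" for n by (rule y)
    show "d (y i) (y j) = d (x i) (x j)" for i j
      using y_le[of i j] y_le[of j i] commute by (cases "i \<le> j") (auto simp: e_def)
    show "\<bar>f (y i) - f (y j)\<bar> < 3 * \<epsilon>" for i j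
      using near[of i] near[of j] colour[of i j] by linarith
  qed
qed

lemma oscillation_stable: "oscillation_stable M"
  unfolding oscillation_stable_def
proof (intro allI impI, elim conjE)
  fix \<epsilon> :: real and f :: "'a \<Rightarrow> real"
  assume \<epsilon>: "0 < \<epsilon>" and uc: "uniformly_continuous_map M euclidean_metric f" and bdd: "bounded (f ` mspace M)"
  \<comment> \<open>The sequence uses three sixths, one for the colour and two for corrections;
    passing to the copy costs one at each end. The last keeps the supremum strictly below
    \<open>\<epsilon>\<close>.\<close>
  have "0 < \<epsilon> / 6" using \<epsilon> by simp
  then obtain \<delta> where "0 < \<delta>"
    "\<forall>z\<in>mspace M. \<forall>y\<in>mspace M. d y z < \<delta> \<longrightarrow> dist (f y) (f z) < \<epsilon> / 6"
    using uc unfolding uniformly_continuous_map_def mdist_euclidean_metric by blast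
  then have \<delta>: "0 < \<delta>"
    "\<And>y z. y \<in> mspace M \<Longrightarrow> z \<in> mspace M \<Longrightarrow> d y z < \<delta> \<Longrightarrow> \<bar>f y - f z\<bar> < \<epsilon> / 6"
    unfolding dist_real_def by blast+
  obtain \<eta> where \<eta>: "\<eta> \<in> dist_set M" "0 < \<eta>" "\<eta> < \<delta>" using small_distance[OF \<delta>(1)] by blast
  obtain x :: "nat \<Rightarrow> 'a" where x: "inj x" "\<And>n. x n \<in> mspace M"
    "\<And>z r. z \<in> mspace M \<Longrightarrow> 0 < r \<Longrightarrow> \<exists>n. d z (x n) < r"
    using dense_sequence by blast
  have "\<exists>y. (\<forall>n. y n \<in> mspace M) \<and> (\<forall>i j. d (y i) (y j) = d (x i) (x j)) \<and>
    (\<forall>i j. \<bar>f (y i) - f (y j)\<bar> < 3 * (\<epsilon> / 6))"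
  proof (rule homogeneous_sequence[OF \<open>0 < \<epsilon> / 6\<close> bdd \<eta>(1,2) _ x(1,2)])
    show "\<bar>f y - f z\<bar> < \<epsilon> / 6" if "y \<in> mspace M" "z \<in> mspace M" "d y z \<le> \<eta>" for y z
      using that \<eta>(3) by (intro \<delta>(2)) auto
  qed
  then obtain y where y: "\<And>n. y n \<in> mspace M" "\<And>i j. d (y i) (y j) = d (x i) (x j)"
    "\<And>i j. \<bar>f (y i) - f (y j)\<bar> < 3 * (\<epsilon> / 6)" by blast
  obtain g where g: "isometric_embedding M M g" "\<And>z r. z \<in> mspace M \<Longrightarrow> 0 < r \<Longrightarrow> \<exists>n. d (y n) (g z) < r"
    using dense_isometry_extends[OF x(2,3) y(1,2)] by blast
  define T where "T = g ` mspace M"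
  have T: "T \<subseteq> mspace M" using g(1) by (auto simp: isometric_embedding_def T_def)
  have "isometry_onto M (submetric M T) g"
    using g(1) T by (auto simp: isometry_onto_def isometric_embedding_def T_def)
  then have "isometric_copy M T" using T unfolding isometric_copy_def by blast
  moreover have "Sup {\<bar>f p - f q\<bar> | p q. p \<in> T \<and> q \<in> T} \<le> 5 * (\<epsilon> / 6)"
  proof (rule cSup_least)
    obtain z where "z \<in> mspace M" using mspace_nonempty .
    then show "{\<bar>f p - f q\<bar> | p q. p \<in> T \<and> q \<in> T} \<noteq> {}" by (auto simp: T_def)
    have near: "\<exists>n. \<bar>f (y n) - f p\<bar> < \<epsilon> / 6" if p: "p \<in> T" for p
    proof -
      obtain z where z: "z \<in> mspace M" "p = g z" using p by (auto simp: T_def)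
      then obtain n where "d (y n) p < \<delta>" using g(2) \<delta>(1) by blast
      then show ?thesis using \<delta>(2) y(1) T p by blast
    qed
    fix r assume "r \<in> {\<bar>f p - f q\<bar> | p q. p \<in> T \<and> q \<in> T}"
    then obtain p q where pq: "p \<in> T" "q \<in> T" "r = \<bar>f p - f q\<bar>" by blast
    obtain m n where "\<bar>f (y m) - f p\<bar> < \<epsilon> / 6" "\<bar>f (y n) - f q\<bar> < \<epsilon> / 6"
      using near[OF pq(1)] near[OF pq(2)] by blast
    then show "r \<le> 5 * (\<epsilon> / 6)" using y(3)[of m n] pq(3) by linarith
  qed
  ultimately show "\<exists>S. isometric_copy M S \<and> Sup {\<bar>f x - f y\<bar> | x y. x \<in> S \<and> y \<in> S} < \<epsilon>"
    using \<epsilon> by (intro exI[of _ T]) auto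
qed

end

theorem theorem8p2:
  fixes M :: "'a metric"
  assumes "Metric_space.mbounded (mspace M) (mdist M) (mspace M)"
    and "uncountable (mspace M)"
    and "separable_space (mtopology_of M)"
    and "mcomplete_of M"
    and "homogeneous_metric M"
    and "universal_metric M"
  shows "oscillation_stable M"
  using assms by (intro homogeneous_universal.oscillation_stable homogeneous_universal.intro)

end
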